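(* Let $\{a_n\}_{n\ge 0}$ be a sequence of real numbers, with $a_n\neq 0$ for all sufficiently large $n$, such that, as $n\to\infty$, \[ \frac{a_{n-1}a_{n+1}}{a_n^2} = 1+\sum_{i=1}^m \frac{r_i(\log n)}{n^{\alpha_i}} + o\left(\frac{1}{n^{\beta}}\right), \] where $m\ge 1$ is an integer, $\alpha_1,\dots,\alpha_m,\beta$ are real numbers with $0<\alpha_1<\alpha_2<\cdots<\alpha_m<\beta$, and $r_1(x),\dots,r_m(x)$ are rational functions of $x$ with real coefficients. Let $\ell=\lfloor \alpha_m/\alpha_1\rfloor$. If either (i) $0<\alpha_1<2$ and $r_1(x)<0$ for all sufficiently large $x$, or (ii) $\alpha_1=2$ and $r_1(x)<-2+\dfrac{1}{2^{\ell-2}}$ for all sufficiently large $x$, then $\{a_n\}_{n\ge 0}$ is asymptotically $\ell$-log-concave.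
   Context: Let $\varphi$ be the operator on real sequences given by $\varphi\{a_n\}_{n\ge 0}=\{a_{n+1}^2-a_na_{n+2}\}_{n\ge 0}$, and let $\varphi^k$ be the composition of $\varphi$ with itself $k$ times. A sequence is $\ell$-log-concave if all terms of the sequences $\varphi\{a_n\},\varphi^2\{a_n\},\dots,\varphi^{\ell}\{a_n\}$ are nonnegative. A sequence $\{a_n\}_{n\ge0}$ is asymptotically $\ell$-log-concave if there is an integer $N$ such that the sequence $\{a_n\}_{n\ge N}$ (re-indexed to start at $0$) is $\ell$-log-concave. *)

theory Defs
  imports
    "HOL-Analysis.Analysis"
    "HOL-Library.Landau_Symbols"
    "HOL-Computational_Algebra.Polynomial"
begin

definition phi :: "(nat \<Rightarrow> real) \<Rightarrow> nat \<Rightarrow> real" where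
  "phi a = (\<lambda>n. (a (n + 1))\<^sup>2 - a n * a (n + 2))"

definition fold_log_concave :: "nat \<Rightarrow> (nat \<Rightarrow> real) \<Rightarrow> bool" where
  "fold_log_concave l a \<longleftrightarrow> (\<forall>k\<in>{1..l}. \<forall>n. (phi ^^ k) a n \<ge> 0)"

definition asymp_fold_log_concave :: "nat \<Rightarrow> (nat \<Rightarrow> real) \<Rightarrow> bool" where
  "asymp_fold_log_concave l a \<longleftrightarrow> (\<exists>N. fold_log_concave l (\<lambda>n. a (n + N)))"

text \<open>A rational function is undefined at the finitely many zeros of its denominator; as
  functions are total here, its values at these points are left unconstrained.\<close>

definition rational_function :: "(real \<Rightarrow> real) \<Rightarrow> bool" where
  "rational_function f \<longleftrightarrow>
     (\<exists>p q :: real poly. q \<noteq> 0 \<and> (\<forall>x. poly q x \<noteq> 0 \<longrightarrow> f x = poly p x / poly q x))"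

end

theory Submission
  imports Defs "HOL-Real_Asymp.Real_Asymp"
begin

text \<open>
  Put \<open>u n = 1 - a (n - 1) * a (n + 1) / (a n)\<^sup>2\<close>. Then \<open>phi a\<close> is, up to a shift, \<open>a\<^sup>2 * u\<close>, so it is
  positive as soon as \<open>u\<close> is, and the corresponding sequence for \<open>phi a\<close> is
  \<open>1 - (1 - u n)\<^sup>2 * (u (n - 1) * u (n + 1) / (u n)\<^sup>2)\<close>. If \<open>u\<close> behaves like \<open>g (ln x) * x powr (- \<alpha>)\<close>,
  the last quotient is \<open>1 + (ln u)''\<close> up to lower order, with
  \<open>(ln u)'' = (\<alpha> + L'' (ln x) - L' (ln x)) / x\<^sup>2\<close> for \<open>L = ln g\<close>. Hence the new leading coefficient is \<open>2 * g\<close>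
  if \<open>\<alpha> < 2\<close> and \<open>2 * g - 2 - (L'' - L')\<close> if \<open>\<alpha> = 2\<close>. It stays positive for the required number of
  steps, while each step worsens the error term \<open>o(n powr (- \<beta>))\<close> by hardly more than the factor
  \<open>n powr \<alpha>\<close>; since \<open>l * \<alpha> < \<beta>\<close>, the error remains negligible in the first \<open>l\<close> sequences.

  The finite differences of the main part are controlled by working with functions all of whose
  derivatives gain a power of \<open>x\<close>.
\<close>

section \<open>Symbol classes\<close>

text \<open>
  \<open>symb J a f\<close>: the \<open>j\<close>-th derivative of \<open>f\<close> is \<open>O(x powr (- a - j))\<close> for all \<open>j \<le> J\<close>. Note the sign:
  a larger order \<open>a\<close> means faster decay.
\<close>

primrec symb :: "nat \<Rightarrow> real \<Rightarrow> (real \<Rightarrow> real) \<Rightarrow> bool" where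
  "symb 0 a f \<longleftrightarrow> f \<in> O(\<lambda>x. x powr (-a))"
| "symb (Suc J) a f \<longleftrightarrow> f \<in> O(\<lambda>x. x powr (-a)) \<and>
     (\<exists>f'. (\<forall>\<^sub>F x in at_top. (f has_real_derivative f' x) (at x)) \<and> symb J (a + 1) f')"

definition symbols :: "real \<Rightarrow> (real \<Rightarrow> real) set" where
  "symbols a = {f. \<forall>J. symb J a f}"

lemma eventually_has_derivative_cong:
  fixes f g :: "real \<Rightarrow> real"
  assumes "\<forall>\<^sub>F x in at_top. f x = g x"
  shows "\<forall>\<^sub>F x in at_top. \<forall>D. (f has_real_derivative D) (at x) \<longleftrightarrow> (g has_real_derivative D) (at x)"
proof -
  obtain X where X: "\<And>x. x \<ge> X \<Longrightarrow> f x = g x"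
    using assms by (auto simp: eventually_at_top_linorder)
  show ?thesis
    using eventually_gt_at_top[of X]
  proof eventually_elim
    case (elim x)
    then have "\<forall>\<^sub>F y in nhds x. f y = g y"
      by (intro eventually_nhds_in_open[of "{X<..}", THEN eventually_mono]) (auto intro: X)
    then show ?case
      using DERIV_cong_ev[OF refl _ refl, of f g x] by blast
  qed
qed

lemma powr_bigo_mono:
  assumes "(a::real) \<le> b"
  shows "(\<lambda>x::real. x powr a) \<in> O(\<lambda>x. x powr b)"
proof (rule bigoI[where c = 1])
  show "\<forall>\<^sub>F x in at_top. norm (x powr a) \<le> 1 * norm (x powr b)"
    using eventually_ge_at_top[of 1] by eventually_elim (use assms in \<open>auto intro: powr_mono\<close>)
qed

lemma symb_bigo: "symb J a f \<Longrightarrow> f \<in> O(\<lambda>x. x powr (-a))"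
  by (cases J) auto

lemma symb_cong:
  assumes "symb J a f" "\<forall>\<^sub>F x in at_top. f x = g x"
  shows "symb J a g"
proof -
  have g: "g \<in> O(\<lambda>x. x powr (-a))"
    using symb_bigo[OF assms(1)] landau_o.big.in_cong[OF assms(2)] by simp
  show ?thesis
  proof (cases J)
    case 0
    then show ?thesis using g by simp
  next
    case (Suc K)
    then obtain f' where f': "\<forall>\<^sub>F x in at_top. (f has_real_derivative f' x) (at x)" "symb K (a + 1) f'"
      using assms(1) by auto
    have "\<forall>\<^sub>F x in at_top. (g has_real_derivative f' x) (at x)"
      using f'(1) eventually_has_derivative_cong[OF assms(2)] by eventually_elim blast
    then show ?thesis using g f' Suc by auto
  qed
qed

lemma symb_mono: "symb J a f \<Longrightarrow> b \<le> a \<Longrightarrow> symb J b f"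
proof (induction J arbitrary: a b f)
  case 0
  then show ?case using landau_o.big_trans[OF _ powr_bigo_mono[of "-a" "-b"]] by simp
next
  case (Suc J)
  then obtain f' where f': "\<forall>\<^sub>F x in at_top. (f has_real_derivative f' x) (at x)" "symb J (a + 1) f'"
    by auto
  have "f \<in> O(\<lambda>x. x powr (-b))"
    using Suc.prems landau_o.big_trans[OF _ powr_bigo_mono[of "-a" "-b"]] by simp
  then show ?case using f' Suc.IH[OF f'(2), of "b + 1"] Suc.prems by auto
qed

lemma symb_pred: "symb (Suc J) a f \<Longrightarrow> symb J a f"
proof (induction J arbitrary: a f)
  case (Suc J)
  then show ?case using symb.simps(2) by blast
qed simp

lemma symb_zero: "symb J a (\<lambda>x. 0)"
proof (induction J arbitrary: a)
  case (Suc J)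
  then show ?case by (auto intro!: exI[of _ "\<lambda>x. 0"])
qed simp

lemma symb_add: "symb J a f \<Longrightarrow> symb J a g \<Longrightarrow> symb J a (\<lambda>x. f x + g x)"
proof (induction J arbitrary: a f g)
  case 0
  then show ?case by (auto intro: sum_in_bigo)
next
  case (Suc J)
  obtain f' g' where
    f': "\<forall>\<^sub>F x in at_top. (f has_real_derivative f' x) (at x)" "symb J (a + 1) f'" and
    g': "\<forall>\<^sub>F x in at_top. (g has_real_derivative g' x) (at x)" "symb J (a + 1) g'"
    using Suc.prems by auto
  have "\<forall>\<^sub>F x in at_top. ((\<lambda>x. f x + g x) has_real_derivative f' x + g' x) (at x)"
    using f'(1) g'(1) by eventually_elim (rule DERIV_add)
  then show ?case using Suc.IH[OF f'(2) g'(2)] Suc.prems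
    by (auto intro!: sum_in_bigo exI[of _ "\<lambda>x. f' x + g' x"])
qed

lemma symb_mult: "symb J a f \<Longrightarrow> symb J b g \<Longrightarrow> symb J (a + b) (\<lambda>x. f x * g x)"
proof (induction J arbitrary: a b f g)
  case 0
  then have "(\<lambda>x. f x * g x) \<in> O(\<lambda>x. x powr (-a) * x powr (-b))"
    by (intro landau_o.big.mult) auto
  then show ?case by (simp flip: powr_add)
next
  case (Suc J)
  obtain f' g' where
    f': "\<forall>\<^sub>F x in at_top. (f has_real_derivative f' x) (at x)" "symb J (a + 1) f'" and
    g': "\<forall>\<^sub>F x in at_top. (g has_real_derivative g' x) (at x)" "symb J (b + 1) g'"
    using Suc.prems by auto
  have 1: "(\<lambda>x. f x * g x) \<in> O(\<lambda>x. x powr (-a) * x powr (-b))"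
    using Suc.prems by (intro landau_o.big.mult) auto
  have 2: "\<forall>\<^sub>F x in at_top. ((\<lambda>x. f x * g x) has_real_derivative f' x * g x + f x * g' x) (at x)"
    using f'(1) g'(1) by eventually_elim (auto intro!: derivative_eq_intros)
  have 3: "symb J (a + b + 1) (\<lambda>x. f' x * g x + f x * g' x)"
    using Suc.IH[OF f'(2) symb_pred[OF Suc.prems(2)]] Suc.IH[OF symb_pred[OF Suc.prems(1)] g'(2)]
    by (intro symb_add) (simp_all add: add_ac)
  show ?case using 1 2 3 by (auto simp flip: powr_add)
qed

lemma symb_const: "symb J 0 (\<lambda>x. c)"
proof (cases J)
  case (Suc K)
  have "(\<lambda>x. c) \<in> O(\<lambda>x::real. x powr (-0))" by real_asymp
  then show ?thesis using Suc symb_zero by (auto intro!: exI[of _ "\<lambda>x. 0"])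
next
  case 0
  have "(\<lambda>x. c) \<in> O(\<lambda>x::real. x powr (-0))" by real_asymp
  then show ?thesis using 0 by simp
qed

lemma symb_cmult: "symb J a f \<Longrightarrow> symb J a (\<lambda>x. c * f x)"
  using symb_mult[OF symb_const] by simp

lemma symb_powr: "symb J (-p) (\<lambda>x. x powr p)"
proof (induction J arbitrary: p)
  case (Suc J)
  have "\<forall>\<^sub>F x in at_top. ((\<lambda>x. x powr p) has_real_derivative p * x powr (p - 1)) (at x)"
    using eventually_gt_at_top[of 0] by eventually_elim (auto intro!: derivative_eq_intros)
  moreover have "symb J (-p + 1) (\<lambda>x. p * x powr (p - 1))"
    using symb_cmult[OF Suc[of "p - 1"]] by (simp add: algebra_simps)
  ultimately show ?case by auto
qed simp

text \<open>The derivative of \<open>1 / f\<close> is \<open>- f' * (1 / f) * (1 / f)\<close>, so the order of smoothness can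
  be raised by one at a time.\<close>

lemma symb_inverse:
  assumes "symb J a f" "c > 0" "\<forall>\<^sub>F x in at_top. \<bar>f x\<bar> \<ge> c * x powr (-a)"
  shows "symb J (-a) (\<lambda>x. 1 / f x)"
  using assms(1)
proof (induction J)
  have nz: "\<forall>\<^sub>F x in at_top. \<bar>f x\<bar> \<ge> c * x powr (-a) \<and> c * x powr (-a) > 0"
    using assms(3) eventually_gt_at_top[of 0] by eventually_elim (use assms(2) in auto)
  have big: "(\<lambda>x. 1 / f x) \<in> O(\<lambda>x. x powr (- (-a)))"
  proof (rule bigoI[where c = "1 / c"])
    show "\<forall>\<^sub>F x in at_top. norm (1 / f x) \<le> 1 / c * norm (x powr (- (-a)))"
      using nz
    proof eventually_elim
      case (elim x)
      then have "1 / \<bar>f x\<bar> \<le> 1 / (c * x powr (-a))"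
        using assms(2) by (intro divide_left_mono mult_pos_pos) auto
      then show ?case by (simp add: powr_minus field_simps)
    qed
  qed
  {
    case 0
    then show ?case using big by simp
  next
    case (Suc J)
    then obtain f' where f': "\<forall>\<^sub>F x in at_top. (f has_real_derivative f' x) (at x)" "symb J (a + 1) f'"
      by auto
    have IH: "symb J (-a) (\<lambda>x. 1 / f x)" using Suc symb_pred by blast
    have 1: "\<forall>\<^sub>F x in at_top. ((\<lambda>x. 1 / f x) has_real_derivative - 1 * (f' x * (1 / f x * (1 / f x)))) (at x)"
      using f'(1) nz by eventually_elim (auto intro!: derivative_eq_intros simp: power2_eq_square)
    have "symb J (a + 1 + (-a + -a)) (\<lambda>x. f' x * (1 / f x * (1 / f x)))"
      by (intro symb_mult f' IH)
    then have "symb J (-a + 1) (\<lambda>x. - 1 * (f' x * (1 / f x * (1 / f x))))"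
      by (intro symb_cmult) (simp add: algebra_simps)
    then show ?case using 1 big by auto
  }
qed

text \<open>Every power of \<open>ln x\<close> is O(x powr \<epsilon>), and by the chain rule each
  derivative brings a factor 1/x. The order \<open>p\<close> is thus forgotten, at the price of an
  arbitrarily small \<epsilon>.\<close>

lemma symb_comp_ln:
  assumes "symb J p g" "\<epsilon> > 0"
  shows "symb J (-\<epsilon>) (\<lambda>x. g (ln x))"
  using assms(1)
proof (induction J arbitrary: p g)
  have big: "(\<lambda>x. g (ln x)) \<in> O(\<lambda>x. x powr (-(-\<epsilon>)))" if "g \<in> O(\<lambda>x. x powr (-p))" for g p
  proof -
    have "(\<lambda>x. g (ln x)) \<in> O(\<lambda>x. ln x powr (-p))"
      using landau_o.big.compose[OF that ln_at_top] .
    also have "(\<lambda>x. ln x powr (-p)) \<in> O(\<lambda>x::real. x powr (-(-\<epsilon>)))"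
      using assms(2) by real_asymp
    finally show ?thesis .
  qed
  {
    case 0
    then show ?case using big by simp
  next
    case (Suc J)
    then obtain g' where g': "\<forall>\<^sub>F x in at_top. (g has_real_derivative g' x) (at x)" "symb J (p + 1) g'"
      by auto
    have "\<forall>\<^sub>F x in at_top. (g has_real_derivative g' (ln x)) (at (ln x))"
      using g'(1) ln_at_top by (rule eventually_compose_filterlim)
    then have 1: "\<forall>\<^sub>F x in at_top. ((\<lambda>x. g (ln x)) has_real_derivative g' (ln x) * x powr (-1)) (at x)"
      using eventually_gt_at_top[of 0]
    proof eventually_elim
      case (elim x)
      from DERIV_chain2[OF elim(1) DERIV_ln[OF elim(2)]] show ?case
        using elim(2) by (simp add: powr_minus)
    qed
    have "symb J (-\<epsilon> + 1) (\<lambda>x. g' (ln x) * x powr (-1))"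
      using symb_mult[OF Suc.IH[OF g'(2)] symb_powr[of J "-1"]] by simp
    then show ?case using 1 big Suc.prems by auto
  }
qed

section \<open>Finite differences and Taylor remainders\<close>

lemma bigo_local_sup:
  fixes g :: "real \<Rightarrow> real"
  assumes "g \<in> O(\<lambda>x. x powr p)" "d \<ge> 0"
  obtains B where "B \<in> O(\<lambda>x. x powr p)" "\<forall>\<^sub>F x in at_top. \<forall>z\<in>{x-d..x+d}. \<bar>g z\<bar> \<le> B x"
proof -
  obtain C where C: "C > 0" "\<forall>\<^sub>F x in at_top. norm (g x) \<le> C * norm (x powr p)"
    using assms(1) by (elim landau_o.bigE)
  obtain X where X: "\<And>x. x \<ge> X \<Longrightarrow> \<bar>g x\<bar> \<le> C * x powr p"
    using C(2) by (auto simp: eventually_at_top_linorder)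
  \<comment> \<open>On the window, the monotone function z powr p is bounded by its value at one
    end; the sum of both end values serves for either sign of p.\<close>
  let ?B = "\<lambda>x::real. C * ((x - d) powr p + (x + d) powr p)"
  have "(\<lambda>x. (x - d) powr p) \<in> O(\<lambda>x. x powr p)" "(\<lambda>x. (x + d) powr p) \<in> O(\<lambda>x. x powr p)"
    by real_asymp+
  then have "(\<lambda>x. (x - d) powr p + (x + d) powr p) \<in> O(\<lambda>x. x powr p)"
    by (rule sum_in_bigo)
  then have "?B \<in> O(\<lambda>x. x powr p)" by simp
  moreover have "\<forall>\<^sub>F x in at_top. \<forall>z\<in>{x-d..x+d}. \<bar>g z\<bar> \<le> ?B x"
    using eventually_ge_at_top[of "X + d"] eventually_gt_at_top[of d]
  proof eventually_elim
    case (elim x)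
    show ?case
    proof
      fix z assume z: "z \<in> {x - d..x + d}"
      have "z powr p \<le> (x - d) powr p + (x + d) powr p"
      proof (cases "p \<ge> 0")
        case True
        then have "z powr p \<le> (x + d) powr p" using z elim by (intro powr_mono2) auto
        then show ?thesis by (simp add: add_increasing)
      next
        case False
        then have "z powr p \<le> (x - d) powr p" using z elim by (intro powr_mono2') auto
        then show ?thesis by (simp add: add_increasing2)
      qed
      then have "C * z powr p \<le> ?B x"
        using C(1) by simp
      then show "\<bar>g z\<bar> \<le> ?B x"
        using X[of z] z elim by auto
    qed
  qed
  ultimately show ?thesis by (rule that)
qed

lemma bigo_local_difference:
  fixes f :: "real \<Rightarrow> real"
  assumes "\<forall>\<^sub>F x in at_top. (f has_real_derivative f' x) (at x)" "f' \<in> O(\<lambda>x. x powr p)" "d \<ge> 0"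
  obtains B where "B \<in> O(\<lambda>x. x powr p)" "\<forall>\<^sub>F x in at_top. \<forall>z\<in>{x-d..x+d}. \<bar>f z - f x\<bar> \<le> B x"
proof -
  obtain B where B: "B \<in> O(\<lambda>x. x powr p)" "\<forall>\<^sub>F x in at_top. \<forall>z\<in>{x-d..x+d}. \<bar>f' z\<bar> \<le> B x"
    using bigo_local_sup[OF assms(2,3)] .
  obtain X where X: "\<And>x. x \<ge> X \<Longrightarrow> (f has_real_derivative f' x) (at x)"
    using assms(1) by (auto simp: eventually_at_top_linorder)
  have "\<forall>\<^sub>F x in at_top. \<forall>z\<in>{x-d..x+d}. \<bar>f z - f x\<bar> \<le> d * B x"
    using eventually_ge_at_top[of "X + d"] B(2)
  proof eventually_elim
    case (elim x)
    show ?case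
    proof
      fix z assume z: "z \<in> {x-d..x+d}"
      have "norm (f z - f x) \<le> B x * norm (z - x)"
      proof (rule field_differentiable_bound[of "{x - d..x + d}"])
        fix y assume y: "y \<in> {x - d..x + d}"
        then show "(f has_field_derivative f' y) (at y within {x - d..x + d})"
          using X[of y] elim by (auto intro: has_field_derivative_at_within)
        show "norm (f' y) \<le> B x" using y elim by auto
      qed (use z assms(3) in auto)
      also have "\<dots> \<le> B x * d"
      proof (rule mult_left_mono)
        have "\<bar>f' x\<bar> \<le> B x" using elim assms(3) by auto
        then show "0 \<le> B x" by linarith
      qed (use z in auto)
      finally show "\<bar>f z - f x\<bar> \<le> d * B x" by (simp add: mult_ac)
    qed
  qed
  moreover have "(\<lambda>x. d * B x) \<in> O(\<lambda>x. x powr p)" using B(1) by simp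
  ultimately show ?thesis using that by blast
qed

lemma bigo_difference:
  fixes f :: "real \<Rightarrow> real"
  assumes "\<forall>\<^sub>F x in at_top. (f has_real_derivative f' x) (at x)" "f' \<in> O(\<lambda>x. x powr p)"
  shows "(\<lambda>x. f (x + c) - f x) \<in> O(\<lambda>x. x powr p)"
proof -
  obtain B where B: "B \<in> O(\<lambda>x. x powr p)"
      "\<forall>\<^sub>F x in at_top. \<forall>z\<in>{x-\<bar>c\<bar>..x+\<bar>c\<bar>}. \<bar>f z - f x\<bar> \<le> B x"
    using bigo_local_difference[OF assms, of "\<bar>c\<bar>"] by auto
  have "(\<lambda>x. f (x + c) - f x) \<in> O(B)"
  proof (rule bigoI[where c = 1])
    show "\<forall>\<^sub>F x in at_top. norm (f (x + c) - f x) \<le> 1 * norm (B x)"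
      using B(2) 
    proof eventually_elim
      case (elim x)
      moreover have "x + c \<in> {x - \<bar>c\<bar>..x + \<bar>c\<bar>}" by auto
      ultimately have "\<bar>f (x + c) - f x\<bar> \<le> B x" by blast
      then show ?case by simp
    qed
  qed
  then show ?thesis using B(1) by (rule landau_o.big_trans)
qed

text \<open>Mean value inequality for \<open>f z - z * f' x\<close>, whose derivative
  \<open>f' z - f' x\<close> is O(x powr p) on the window by the bound on
  \<open>f''\<close>.\<close>

lemma bigo_taylor:
  fixes f :: "real \<Rightarrow> real"
  assumes "\<forall>\<^sub>F x in at_top. (f has_real_derivative f' x) (at x)"
    and "\<forall>\<^sub>F x in at_top. (f' has_real_derivative f'' x) (at x)" "f'' \<in> O(\<lambda>x. x powr p)"
  shows "(\<lambda>x. f (x + c) - f x - c * f' x) \<in> O(\<lambda>x. x powr p)"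
proof -
  let ?d = "\<bar>c\<bar>"
  obtain B where B: "B \<in> O(\<lambda>x. x powr p)"
      "\<forall>\<^sub>F x in at_top. \<forall>z\<in>{x-?d..x+?d}. \<bar>f' z - f' x\<bar> \<le> B x"
    using bigo_local_difference[OF assms(2,3), of "?d"] by auto
  obtain X where X: "\<And>x. x \<ge> X \<Longrightarrow> (f has_real_derivative f' x) (at x)"
    using assms(1) by (auto simp: eventually_at_top_linorder)
  have "(\<lambda>x. f (x + c) - f x - c * f' x) \<in> O(\<lambda>x. ?d * B x)"
  proof (rule bigoI[where c = 1])
    show "\<forall>\<^sub>F x in at_top. norm (f (x + c) - f x - c * f' x) \<le> 1 * norm (?d * B x)"
      using B(2) eventually_ge_at_top[of "X + ?d"]
    proof eventually_elim
      case (elim x)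
      have "norm ((f (x + c) - (x + c) * f' x) - (f x - x * f' x)) \<le> B x * norm ((x + c) - x)"
      proof (rule field_differentiable_bound[of "{x - ?d..x + ?d}" "\<lambda>z. f z - z * f' x" "\<lambda>z. f' z - f' x"])
        fix y assume y: "y \<in> {x - ?d..x + ?d}"
        have "((\<lambda>z. f z - z * f' x) has_field_derivative f' y - f' x) (at y)"
          using X[of y] elim y by (auto intro!: derivative_eq_intros)
        then show "((\<lambda>z. f z - z * f' x) has_field_derivative f' y - f' x) (at y within {x - ?d..x + ?d})"
          by (rule has_field_derivative_at_within)
        show "norm (f' y - f' x) \<le> B x" using y elim by auto
      qed auto
      moreover have "(f (x + c) - (x + c) * f' x) - (f x - x * f' x) = f (x + c) - f x - c * f' x"
        by (simp add: algebra_simps)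
      moreover have "0 \<le> B x" using elim(1)[rule_format, of x] by auto
      ultimately show ?case by (simp add: abs_mult mult_ac)
    qed
  qed
  moreover have "(\<lambda>x. ?d * B x) \<in> O(\<lambda>x. x powr p)" using B(1) by simp
  ultimately show ?thesis by (rule landau_o.big_trans)
qed

lemma eventually_has_derivative_shift:
  fixes f :: "real \<Rightarrow> real"
  assumes "\<forall>\<^sub>F x in at_top. (f has_real_derivative f' x) (at x)"
  shows "\<forall>\<^sub>F x in at_top. ((\<lambda>x. f (x + c)) has_real_derivative f' (x + c)) (at x)"
proof -
  have "filterlim (\<lambda>x::real. x + c) at_top at_top" by real_asymp
  from eventually_compose_filterlim[OF assms this] show ?thesis
    by eventually_elim (simp add: DERIV_shift)
qed

text \<open>The derivative of a difference is the difference of the derivative, so the gain of one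
  order passes on to all derivatives.\<close>

lemma symb_difference: "symb (Suc J) a f \<Longrightarrow> symb J (a + 1) (\<lambda>x. f (x + c) - f x)"
proof (induction J arbitrary: a f)
  case 0
  then show ?case using bigo_difference by auto
next
  case (Suc J)
  then obtain f' where f': "\<forall>\<^sub>F x in at_top. (f has_real_derivative f' x) (at x)" "symb (Suc J) (a + 1) f'"
    by auto
  have "\<forall>\<^sub>F x in at_top. ((\<lambda>x. f (x + c) - f x) has_real_derivative f' (x + c) - f' x) (at x)"
    using eventually_has_derivative_shift[OF f'(1), of c] f'(1) by eventually_elim (rule DERIV_diff)
  then show ?case using Suc.IH[OF f'(2)] bigo_difference[OF f'(1) symb_bigo[OF f'(2)]] by auto
qed

section \<open>Symbols with control of all derivatives\<close>

lemma symbols_iff: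
  "f \<in> symbols a \<longleftrightarrow> f \<in> O(\<lambda>x. x powr (-a)) \<and>
     (\<forall>\<^sub>F x in at_top. (f has_real_derivative deriv f x) (at x)) \<and> deriv f \<in> symbols (a + 1)"
proof
  assume f: "f \<in> symbols a"
  \<comment> \<open>\<open>symb\<close> supplies a derivative that may depend on \<open>J\<close>;
    all of these eventually agree with \<open>deriv f\<close>, which makes the choice
    uniform.\<close>
  have *: "(\<forall>\<^sub>F x in at_top. (f has_real_derivative deriv f x) (at x)) \<and> symb J (a + 1) (deriv f)" for J
  proof -
    have "symb (Suc J) a f" using f by (simp add: symbols_def del: symb.simps)
    then obtain f' where f': "\<forall>\<^sub>F x in at_top. (f has_real_derivative f' x) (at x)" "symb J (a + 1) f'"
      by auto
    have 1: "\<forall>\<^sub>F x in at_top. f' x = deriv f x"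
      using f'(1) by eventually_elim (simp add: DERIV_imp_deriv)
    show ?thesis using symb_cong[OF f'(2) 1] f'(1) 1
      by (auto elim: eventually_elim2)
  qed
  show "f \<in> O(\<lambda>x. x powr (-a)) \<and> (\<forall>\<^sub>F x in at_top. (f has_real_derivative deriv f x) (at x)) \<and>
      deriv f \<in> symbols (a + 1)"
    using * f symb_bigo by (auto simp: symbols_def)
next
  assume *: "f \<in> O(\<lambda>x. x powr (-a)) \<and>
     (\<forall>\<^sub>F x in at_top. (f has_real_derivative deriv f x) (at x)) \<and> deriv f \<in> symbols (a + 1)"
  have "symb J a f" for J
    using * by (cases J) (auto simp: symbols_def)
  then show "f \<in> symbols a" by (simp add: symbols_def)
qed

lemma symbols_bigo: "f \<in> symbols a \<Longrightarrow> f \<in> O(\<lambda>x. x powr (-a))"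
  and symbols_has_deriv: "f \<in> symbols a \<Longrightarrow> \<forall>\<^sub>F x in at_top. (f has_real_derivative deriv f x) (at x)"
  and symbols_deriv: "f \<in> symbols a \<Longrightarrow> deriv f \<in> symbols (a + 1)"
  using symbols_iff by blast+

lemma symbols_cong: "f \<in> symbols a \<Longrightarrow> \<forall>\<^sub>F x in at_top. f x = g x \<Longrightarrow> g \<in> symbols a"
  unfolding symbols_def by (blast intro: symb_cong)

lemma symbols_mono: "f \<in> symbols a \<Longrightarrow> b \<le> a \<Longrightarrow> f \<in> symbols b"
  unfolding symbols_def by (blast intro: symb_mono)

lemma symbols_const: "(\<lambda>x. c) \<in> symbols 0"
  using symb_const by (auto simp: symbols_def)

lemma symbols_zero: "(\<lambda>x. 0) \<in> symbols a"
  using symb_zero by (auto simp: symbols_def)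

lemma symbols_add: "f \<in> symbols a \<Longrightarrow> g \<in> symbols a \<Longrightarrow> (\<lambda>x. f x + g x) \<in> symbols a"
  using symb_add by (auto simp: symbols_def)

lemma symbols_mult: "f \<in> symbols a \<Longrightarrow> g \<in> symbols b \<Longrightarrow> (\<lambda>x. f x * g x) \<in> symbols (a + b)"
  using symb_mult by (auto simp: symbols_def)

lemma symbols_cmult: "f \<in> symbols a \<Longrightarrow> (\<lambda>x. c * f x) \<in> symbols a"
  using symb_cmult by (auto simp: symbols_def)

lemma symbols_diff: "f \<in> symbols a \<Longrightarrow> g \<in> symbols a \<Longrightarrow> (\<lambda>x. f x - g x) \<in> symbols a"
  using symbols_add[of f a "\<lambda>x. - 1 * g x"] symbols_cmult[of g a "-1"] by simp

lemma symbols_powr: "(\<lambda>x. x powr p) \<in> symbols (-p)"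
  using symb_powr by (auto simp: symbols_def)

lemma symbols_inverse:
  assumes "f \<in> symbols a" "c > 0" "\<forall>\<^sub>F x in at_top. \<bar>f x\<bar> \<ge> c * x powr (-a)"
  shows "(\<lambda>x. 1 / f x) \<in> symbols (-a)"
  using assms symb_inverse by (auto simp: symbols_def)

lemma symbols_comp_ln: "g \<in> symbols p \<Longrightarrow> \<epsilon> > 0 \<Longrightarrow> (\<lambda>x. g (ln x)) \<in> symbols (-\<epsilon>)"
  unfolding symbols_def by (blast intro: symb_comp_ln)

lemma symbols_difference: "f \<in> symbols a \<Longrightarrow> (\<lambda>x. f (x + c) - f x) \<in> symbols (a + 1)"
  using symb_difference by (auto simp: symbols_def simp del: symb.simps)

text \<open>The derivative of the first-order remainder of \<open>f\<close> is the first-order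
  remainder of \<open>deriv f\<close>, so one size estimate suffices for all derivatives.\<close>

lemma symbols_taylor:
  assumes "f \<in> symbols a"
  shows "(\<lambda>x. f (x + c) - f x - c * deriv f x) \<in> symbols (a + 2)"
proof -
  have "symb J (a + 2) (\<lambda>x. f (x + c) - f x - c * deriv f x)" for J
    using assms
  proof (induction J arbitrary: a f)
    have *: "(\<lambda>x. f (x + c) - f x - c * deriv f x) \<in> O(\<lambda>x. x powr (-(a+2)))"
      if f: "f \<in> symbols a" for f a
    proof (rule bigo_taylor)
      show "deriv (deriv f) \<in> O(\<lambda>x. x powr - (a + 2))"
        using symbols_bigo[OF symbols_deriv[OF symbols_deriv[OF f]]] by (simp add: add_ac)
    qed (use symbols_has_deriv[OF f] symbols_has_deriv[OF symbols_deriv[OF f]] in auto)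
    {
      case 0
      then show ?case using * by simp
    next
      case (Suc J)
      note d = symbols_has_deriv[OF Suc.prems] and d' = symbols_has_deriv[OF symbols_deriv[OF Suc.prems]]
      have "\<forall>\<^sub>F x in at_top. ((\<lambda>x. f (x + c) - f x - c * deriv f x) has_real_derivative
              deriv f (x + c) - deriv f x - c * deriv (deriv f) x) (at x)"
        using eventually_has_derivative_shift[OF d, of c] d d'
        by eventually_elim (auto intro!: derivative_eq_intros)
      moreover have "symb J (a + 2 + 1) (\<lambda>x. deriv f (x + c) - deriv f x - c * deriv (deriv f) x)"
        using Suc.IH[OF symbols_deriv[OF Suc.prems]] by (simp add: add_ac)
      ultimately show ?case using *[OF Suc.prems] by auto
    }
  qed
  then show ?thesis by (simp add: symbols_def)
qed

section \<open>Symbols up to an arbitrarily small loss or with a small gain\<close>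

text \<open>Functions of \<open>ln x\<close> have order 0 only up to an arbitrarily small power;
  quantifying over all smaller orders keeps these losses out of the bookkeeping.\<close>

definition symbols_ess :: "real \<Rightarrow> (real \<Rightarrow> real) set" where
  "symbols_ess a = {f. \<forall>b<a. f \<in> symbols b}"

text \<open>The negligible terms: a gain of some fixed power survives multiplication by factors
  whose order is known only up to logarithms.\<close>

definition symbols_sub :: "real \<Rightarrow> (real \<Rightarrow> real) set" where
  "symbols_sub a = {f. \<exists>b>a. f \<in> symbols b}"

lemma symbols_subset_ess: "f \<in> symbols a \<Longrightarrow> f \<in> symbols_ess a"
  by (auto simp: symbols_ess_def intro: symbols_mono)

lemma symbols_ess_imp_sub: "f \<in> symbols_ess b \<Longrightarrow> a < b \<Longrightarrow> f \<in> symbols_sub a"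
  using dense[of a b] by (auto simp: symbols_ess_def symbols_sub_def)

lemma symbols_sub_imp_ess: "f \<in> symbols_sub a \<Longrightarrow> f \<in> symbols_ess a"
  by (auto simp: symbols_ess_def symbols_sub_def intro: symbols_mono)

lemma symbols_ess_mono: "f \<in> symbols_ess a \<Longrightarrow> b \<le> a \<Longrightarrow> f \<in> symbols_ess b"
  by (auto simp: symbols_ess_def)

lemma symbols_sub_mono: "f \<in> symbols_sub a \<Longrightarrow> b \<le> a \<Longrightarrow> f \<in> symbols_sub b"
  unfolding symbols_sub_def by force

lemma symbols_ess_cong: "f \<in> symbols_ess a \<Longrightarrow> \<forall>\<^sub>F x in at_top. f x = g x \<Longrightarrow> g \<in> symbols_ess a"
  by (auto simp: symbols_ess_def intro: symbols_cong)

lemma symbols_sub_cong: "f \<in> symbols_sub a \<Longrightarrow> \<forall>\<^sub>F x in at_top. f x = g x \<Longrightarrow> g \<in> symbols_sub a"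
  by (auto simp: symbols_sub_def intro: symbols_cong)

lemma symbols_ess_mult:
  assumes "f \<in> symbols_ess a" "g \<in> symbols_ess b"
  shows "(\<lambda>x. f x * g x) \<in> symbols_ess (a + b)"
proof -
  have "(\<lambda>x. f x * g x) \<in> symbols c" if "c < a + b" for c
  proof -
    \<comment> \<open>The slack \<open>a + b - c\<close> is shared equally between the two
      factors.\<close>
    have "f \<in> symbols (a - (a + b - c) / 2)" "g \<in> symbols (b - (a + b - c) / 2)"
      using assms that by (auto simp: symbols_ess_def)
    from symbols_mult[OF this] show ?thesis by (simp add: field_simps)
  qed
  then show ?thesis by (simp add: symbols_ess_def)
qed

lemma symbols_sub_mult:
  assumes "f \<in> symbols_sub a" "g \<in> symbols_ess b"
  shows "(\<lambda>x. f x * g x) \<in> symbols_sub (a + b)"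
proof -
  obtain c where c: "c > a" "f \<in> symbols c" using assms by (auto simp: symbols_sub_def)
  then have "(\<lambda>x. f x * g x) \<in> symbols_ess (c + b)"
    using assms symbols_ess_mult symbols_subset_ess by blast
  then show ?thesis using c by (auto intro: symbols_ess_imp_sub)
qed

lemma symbols_ess_add:
  "f \<in> symbols_ess a \<Longrightarrow> g \<in> symbols_ess a \<Longrightarrow> (\<lambda>x. f x + g x) \<in> symbols_ess a"
  by (auto simp: symbols_ess_def intro: symbols_add)

lemma symbols_ess_diff:
  "f \<in> symbols_ess a \<Longrightarrow> g \<in> symbols_ess a \<Longrightarrow> (\<lambda>x. f x - g x) \<in> symbols_ess a"
  by (auto simp: symbols_ess_def intro: symbols_diff)

lemma symbols_ess_cmult: "f \<in> symbols_ess a \<Longrightarrow> (\<lambda>x. c * f x) \<in> symbols_ess a"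
  by (auto simp: symbols_ess_def intro: symbols_cmult)

lemma symbols_sub_add:
  assumes "f \<in> symbols_sub a" "g \<in> symbols_sub a"
  shows "(\<lambda>x. f x + g x) \<in> symbols_sub a"
proof -
  obtain b c where "b > a" "f \<in> symbols b" "c > a" "g \<in> symbols c"
    using assms by (auto simp: symbols_sub_def)
  then have "(\<lambda>x. f x + g x) \<in> symbols (min b c)" "min b c > a"
    by (auto intro!: symbols_add intro: symbols_mono)
  then show ?thesis unfolding symbols_sub_def by blast
qed

lemma symbols_sub_zero: "(\<lambda>x. 0) \<in> symbols_sub a"
  unfolding symbols_sub_def using symbols_zero gt_ex by blast

lemma symbols_sub_cmult: "f \<in> symbols_sub a \<Longrightarrow> (\<lambda>x. c * f x) \<in> symbols_sub a"
  by (auto simp: symbols_sub_def intro: symbols_cmult)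

lemma symbols_sub_diff:
  "f \<in> symbols_sub a \<Longrightarrow> g \<in> symbols_sub a \<Longrightarrow> (\<lambda>x. f x - g x) \<in> symbols_sub a"
  using symbols_sub_add[of f a "\<lambda>x. - 1 * g x"] symbols_sub_cmult[of g a "-1"] by simp

lemma symbols_sub_sum:
  "(\<And>i. i \<in> I \<Longrightarrow> f i \<in> symbols_sub a) \<Longrightarrow> (\<lambda>x. \<Sum>i\<in>I. f i x) \<in> symbols_sub a"
proof (induction I rule: infinite_finite_induct)
  case (insert i I)
  then show ?case using symbols_sub_add[of "f i" a "\<lambda>x. \<Sum>i\<in>I. f i x"] by simp
qed (simp_all add: symbols_sub_zero)

lemma symbols_ess_has_deriv:
  "f \<in> symbols_ess a \<Longrightarrow> \<forall>\<^sub>F x in at_top. (f has_real_derivative deriv f x) (at x)"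
  using lt_ex[of a] symbols_has_deriv by (auto simp: symbols_ess_def)

text \<open>Common pattern for derivatives, differences and Taylor remainders, each of which shifts
  every order by the same amount.\<close>

lemma symbols_ess_lift:
  assumes "f \<in> symbols_ess a" "\<And>b. f \<in> symbols b \<Longrightarrow> F \<in> symbols (b + c)"
  shows "F \<in> symbols_ess (a + c)"
  using assms(1) assms(2)[of "_ - c"] by (auto simp: symbols_ess_def)

lemma symbols_ess_deriv: "f \<in> symbols_ess a \<Longrightarrow> deriv f \<in> symbols_ess (a + 1)"
  by (erule symbols_ess_lift) (rule symbols_deriv)

lemma symbols_sub_deriv: "f \<in> symbols_sub a \<Longrightarrow> deriv f \<in> symbols_sub (a + 1)"
  using symbols_deriv unfolding symbols_sub_def by force

lemma symbols_ess_difference: "f \<in> symbols_ess a \<Longrightarrow> (\<lambda>x. f (x + c) - f x) \<in> symbols_ess (a + 1)"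
  by (erule symbols_ess_lift) (rule symbols_difference)

lemma symbols_ess_taylor:
  "f \<in> symbols_ess a \<Longrightarrow> (\<lambda>x. f (x + c) - f x - c * deriv f x) \<in> symbols_ess (a + 2)"
  by (erule symbols_ess_lift) (rule symbols_taylor)

section \<open>Logarithmic derivatives and second differences\<close>

definition log_deriv :: "(real \<Rightarrow> real) \<Rightarrow> real \<Rightarrow> real" where
  "log_deriv f x = deriv f x / f x"

lemma symbols_ess_log_deriv:
  assumes "f \<in> symbols_ess a" "(\<lambda>x. 1 / f x) \<in> symbols_ess (-a)"
  shows "log_deriv f \<in> symbols_ess 1"
  using symbols_ess_mult[OF symbols_ess_deriv[OF assms(1)] assms(2)] by (simp add: log_deriv_def [abs_def])

text \<open>The function is (f(x-1) f(x+1) - f^2 - f f'' + f'^2) / f^2. By cancellation the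
  numerator has order 2a + 3, one more than its summand f f'', and dividing by f^2 costs 2a.\<close>

lemma second_difference_ratio:
  assumes f: "f \<in> symbols_ess a" and f1: "(\<lambda>x. 1 / f x) \<in> symbols_ess (-a)"
    and nz: "\<forall>\<^sub>F x in at_top. f x \<noteq> 0"
  shows "(\<lambda>x. f (x - 1) * f (x + 1) / (f x)\<^sup>2 - 1 - deriv (log_deriv f) x) \<in> symbols_ess 3"
proof -
  define f' where "f' = deriv f"
  define f'' where "f'' = deriv f'"
  define R where "R = (\<lambda>x. f (x - 1) - f x + f' x)"
  define S where "S = (\<lambda>x. f (x + 1) - f x - f' x)"
  define Q where "Q = (\<lambda>x. f' (x + 1) - f' x - f'' x)"
  define P where "P = (\<lambda>x. R (x + 1) - R x)"
  have f': "f' \<in> symbols_ess (a + 1)"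
    unfolding f'_def using f symbols_ess_deriv by auto
  have R: "R \<in> symbols_ess (a + 2)"
    using symbols_ess_taylor[OF f, of "-1"] by (simp add: R_def f'_def)
  have S: "S \<in> symbols_ess (a + 2)"
    using symbols_ess_taylor[OF f, of "1"] by (simp add: S_def f'_def)
  have Q: "Q \<in> symbols_ess (a + 3)"
    using symbols_ess_taylor[OF f', of 1] by (simp add: Q_def f''_def add_ac)
  have P: "P \<in> symbols_ess (a + 3)"
    using symbols_ess_difference[OF R, of 1] by (simp add: P_def add_ac)
  have A: "(\<lambda>x. f x * (Q x - P x)) \<in> symbols_ess (a + (a + 3))"
    by (intro symbols_ess_mult symbols_ess_diff f P Q)
  have "(\<lambda>x. R x * f' x) \<in> symbols_ess ((a + 2) + (a + 1))"
       "(\<lambda>x. f' x * S x) \<in> symbols_ess ((a + 1) + (a + 2))"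
       "(\<lambda>x. R x * S x) \<in> symbols_ess ((a + 2) + (a + 2))"
    by (intro symbols_ess_mult R S f')+
  then have B: "(\<lambda>x. R x * f' x + R x * S x - f' x * S x) \<in> symbols_ess (a + (a + 3))"
    by (intro symbols_ess_add symbols_ess_diff) (auto elim: symbols_ess_mono)
  have E: "(\<lambda>x. (f x * (Q x - P x) + (R x * f' x + R x * S x - f' x * S x)) * (1 / f x * (1 / f x)))
     \<in> symbols_ess ((a + (a + 3)) + (-a + -a))"
    by (rule symbols_ess_mult[OF symbols_ess_add[OF A B] symbols_ess_mult[OF f1 f1]])
  have "\<forall>\<^sub>F x in at_top. deriv (log_deriv f) x = f'' x / f x - f' x ^ 2 / f x ^ 2"
    using nz symbols_ess_has_deriv[OF f] symbols_ess_has_deriv[OF f']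
  proof eventually_elim
    case (elim x)
    have "(log_deriv f has_real_derivative f'' x / f x - f' x ^ 2 / f x ^ 2) (at x)"
      unfolding log_deriv_def[abs_def] f'_def[symmetric]
      using elim by (auto intro!: derivative_eq_intros simp: f'_def f''_def field_simps power2_eq_square)
    then show ?case by (rule DERIV_imp_deriv)
  qed
  then have "\<forall>\<^sub>F x in at_top. (f x * (Q x - P x) + (R x * f' x + R x * S x - f' x * S x)) * (1 / f x * (1 / f x))
      = f (x - 1) * f (x + 1) / (f x)\<^sup>2 - 1 - deriv (log_deriv f) x"
    using nz
  proof eventually_elim
    case (elim x)
    have 1: "f (x - 1) = f x - f' x + R x" "f (x + 1) = f x + f' x + S x" by (auto simp: R_def S_def)
    \<comment> \<open>Separate estimates of \<open>R\<close> and \<open>S\<close> give only order a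
      + 2. Expanding backwards from x + 1 as well shows that R + S - f'' = Q - P, which has order a
      + 3.\<close>
    have "f x = f (x + 1) - f' (x + 1) + R (x + 1)" by (auto simp: R_def)
    then have 2: "S x = Q x + f'' x - P x - R x" unfolding P_def Q_def S_def by algebra
    have "f (x - 1) * f (x + 1) - (f x)\<^sup>2 - f x * f'' x + (f' x)\<^sup>2 
       = f x * (Q x - P x) + (R x * f' x + R x * S x - f' x * S x)"
      unfolding 1 using 2 by algebra
    then have "(f x * (Q x - P x) + (R x * f' x + R x * S x - f' x * S x)) * (1 / f x * (1 / f x)) =
      (f (x - 1) * f (x + 1) - (f x)\<^sup>2 - f x * f'' x + (f' x)\<^sup>2) / (f x)\<^sup>2"
      by (simp add: power2_eq_square)
    also have "\<dots> = f (x - 1) * f (x + 1) / (f x)\<^sup>2 - 1 - (f'' x / f x - f' x ^ 2 / f x ^ 2)"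
      using elim(2) by (simp add: add_divide_distrib diff_divide_distrib power2_eq_square)
    finally show ?case using elim(1) by simp
  qed
  with E show ?thesis by (auto intro: symbols_ess_cong)
qed

section \<open>Perturbations that are smaller by a power\<close>

lemma symbols_sub_tendsto_0:
  assumes "k \<in> symbols_sub 0"
  shows "(k \<longlongrightarrow> 0) at_top"
proof -
  obtain b where b: "b > 0" "k \<in> symbols b" using assms by (auto simp: symbols_sub_def)
  have "k \<in> O(\<lambda>x. x powr (-b))" using symbols_bigo[OF b(2)] .
  also have "(\<lambda>x. x powr (-b)) \<in> o(\<lambda>x::real. 1)" using b(1) by real_asymp
  finally show ?thesis by (auto dest: smalloD_tendsto)
qed

text \<open>Factor G + h = (1 + k) G with k = h / G tending to 0; then 1 + k is bounded away from
  zero and its reciprocal is a symbol of order 0.\<close>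

lemma perturbation_inverse:
  assumes "(\<lambda>x. 1 / G x) \<in> symbols_ess 0" "\<forall>\<^sub>F x in at_top. G x \<noteq> 0" "h \<in> symbols_sub 0"
  shows "(\<lambda>x. 1 / (G x + h x)) \<in> symbols_ess 0" "\<forall>\<^sub>F x in at_top. G x + h x \<noteq> 0"
proof -
  define k where "k = (\<lambda>x. h x * (1 / G x))"
  have k: "k \<in> symbols_sub 0" using symbols_sub_mult[OF assms(3,1)] by (simp add: k_def)
  then obtain b where b: "b > 0" "k \<in> symbols b" by (auto simp: symbols_sub_def)
  have "\<forall>\<^sub>F x in at_top. \<bar>k x\<bar> < 1 / 2"
    using tendsto_rabs[OF symbols_sub_tendsto_0[OF k]] by (rule order_tendstoD) simp
  then have lower: "\<forall>\<^sub>F x in at_top. \<bar>1 + k x\<bar> \<ge> 1 / 2 * x powr (-0)"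
    using eventually_gt_at_top[of 0] by eventually_elim auto
  have "(\<lambda>x. 1 + k x) \<in> symbols 0"
    using b by (intro symbols_add symbols_const symbols_mono[OF b(2)]) auto
  from symbols_inverse[OF this _ lower] have "(\<lambda>x. 1 / (1 + k x)) \<in> symbols 0" by simp
  from symbols_ess_mult[OF symbols_subset_ess[OF this] assms(1)]
  have 1: "(\<lambda>x. 1 / (1 + k x) * (1 / G x)) \<in> symbols_ess 0" by simp
  have ev: "\<forall>\<^sub>F x in at_top. G x + h x \<noteq> 0 \<and> 1 / (1 + k x) * (1 / G x) = 1 / (G x + h x)"
    using lower assms(2) eventually_gt_at_top[of 0]
  proof eventually_elim
    case (elim x)
    have "G x + h x = (1 + k x) * G x" using elim by (simp add: k_def field_simps)
    moreover have "1 + k x \<noteq> 0" using elim by auto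
    ultimately show ?case using elim by simp
  qed
  show "\<forall>\<^sub>F x in at_top. G x + h x \<noteq> 0" using ev by eventually_elim simp
  show "(\<lambda>x. 1 / (G x + h x)) \<in> symbols_ess 0"
    by (rule symbols_ess_cong[OF 1]) (use ev in eventually_elim, simp)
qed

text \<open>With F = G + h, F'/F - G'/G = (h' G - h G') / (F G). Each term contains h or h' and so
  keeps the gain of h; one more derivative raises the order from 1 to 2.\<close>

lemma log_deriv_perturbation:
  assumes G: "G \<in> symbols_ess 0" "(\<lambda>x. 1 / G x) \<in> symbols_ess 0" "\<forall>\<^sub>F x in at_top. G x \<noteq> 0"
    and h: "h \<in> symbols_sub 0"
  shows "(\<lambda>x. deriv (log_deriv (\<lambda>x. G x + h x)) x - deriv (log_deriv G) x) \<in> symbols_sub 2"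
proof -
  define F where "F = (\<lambda>x. G x + h x)"
  have F1: "(\<lambda>x. 1 / F x) \<in> symbols_ess 0" and Fnz: "\<forall>\<^sub>F x in at_top. F x \<noteq> 0"
    using perturbation_inverse[OF G(2,3) h] by (auto simp: F_def)
  have F: "F \<in> symbols_ess 0"
    unfolding F_def by (intro symbols_ess_add G symbols_sub_imp_ess h)
  have "(\<lambda>x. deriv h x * G x) \<in> symbols_sub (0 + 1 + 0)" "(\<lambda>x. h x * deriv G x) \<in> symbols_sub (0 + (0 + 1))"
    by (intro symbols_sub_mult symbols_sub_deriv symbols_ess_deriv h G)+
  then have "(\<lambda>x. deriv h x * G x - h x * deriv G x) \<in> symbols_sub 1"
    by (intro symbols_sub_diff) simp_all
  from symbols_sub_mult[OF this symbols_ess_mult[OF F1 G(2)]]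
  have 1: "(\<lambda>x. (deriv h x * G x - h x * deriv G x) * (1 / F x * (1 / G x))) \<in> symbols_sub 1" by simp
  have "\<forall>\<^sub>F x in at_top. (deriv h x * G x - h x * deriv G x) * (1 / F x * (1 / G x))
     = log_deriv F x - log_deriv G x"
    using Fnz G(3) symbols_ess_has_deriv[OF G(1)] symbols_ess_has_deriv[OF symbols_sub_imp_ess[OF h]]
  proof eventually_elim
    case (elim x)
    have "(F has_real_derivative deriv G x + deriv h x) (at x)"
      using elim unfolding F_def by (auto intro!: derivative_eq_intros)
    then have d: "deriv F x = deriv G x + deriv h x" by (rule DERIV_imp_deriv)
    show ?case using elim(1,2) unfolding log_deriv_def d
      by (simp add: divide_simps) (simp add: F_def algebra_simps)
  qed
  from symbols_sub_cong[OF 1 this] have 2: "(\<lambda>x. log_deriv F x - log_deriv G x) \<in> symbols_sub 1" .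
  have 3: "log_deriv F \<in> symbols_ess 1" "log_deriv G \<in> symbols_ess 1"
    using symbols_ess_log_deriv[of F 0] symbols_ess_log_deriv[of G 0] F F1 G by auto
  have "\<forall>\<^sub>F x in at_top. deriv (\<lambda>x. log_deriv F x - log_deriv G x) x = deriv (log_deriv F) x - deriv (log_deriv G) x"
    using symbols_ess_has_deriv[OF 3(1)] symbols_ess_has_deriv[OF 3(2)]
    by eventually_elim (auto intro!: DERIV_imp_deriv DERIV_diff)
  from symbols_sub_cong[OF symbols_sub_deriv[OF 2] this] show ?thesis by (simp add: F_def)
qed

text \<open>Formally the logarithm is \<open>- \<alpha> * ln x + ln F\<close>, and the second
  derivative of its first summand is \<alpha> / x^2.\<close>

lemma deriv_log_deriv_powr_mult:
  assumes F: "F \<in> symbols_ess 0" "(\<lambda>x. 1 / F x) \<in> symbols_ess 0" "\<forall>\<^sub>F x in at_top. F x \<noteq> 0"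
  shows "\<forall>\<^sub>F x in at_top. deriv (log_deriv (\<lambda>x. x powr (-\<alpha>) * F x)) x
           = x powr (-2) * \<alpha> + deriv (log_deriv F) x"
proof -
  let ?f = "\<lambda>x. x powr (-\<alpha>) * F x"
  have lF: "log_deriv F \<in> symbols_ess 1"
    using symbols_ess_log_deriv[of F 0] F by auto
  have 1: "\<forall>\<^sub>F x in at_top. log_deriv ?f x = log_deriv F x - \<alpha> / x"
    using F(3) symbols_ess_has_deriv[OF F(1)] eventually_gt_at_top[of 0]
  proof eventually_elim
    case (elim x)
    have "(?f has_real_derivative x powr (-\<alpha>) * deriv F x + (- \<alpha> * x powr (-\<alpha> - 1)) * F x) (at x)"
      using elim by (auto intro!: derivative_eq_intros)
    then have d: "deriv ?f x = x powr (-\<alpha>) * deriv F x + (- \<alpha> * x powr (-\<alpha> - 1)) * F x"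
      by (rule DERIV_imp_deriv)
    show ?case using elim unfolding log_deriv_def d by (simp add: powr_diff field_simps)
  qed
  have "\<forall>\<^sub>F x in at_top. ((\<lambda>x. log_deriv F x - \<alpha> / x) has_real_derivative
          x powr (-2) * \<alpha> + deriv (log_deriv F) x) (at x)"
    using symbols_ess_has_deriv[OF lF] eventually_gt_at_top[of 0]
    by eventually_elim (auto intro!: derivative_eq_intros simp: powr_minus field_simps power2_eq_square)
  then show ?thesis
    using eventually_has_derivative_cong[OF 1] by eventually_elim (auto intro!: DERIV_imp_deriv)
qed

text \<open>With L = ln g, differentiating L(ln x) twice gives (L'' - L')(ln x) / x^2; the minus
  sign comes from the derivative of 1/x.\<close>

lemma deriv_log_deriv_comp_ln:
  assumes g: "\<forall>\<^sub>F x in at_top. (g has_real_derivative deriv g x) (at x)"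
    and lg: "\<forall>\<^sub>F x in at_top. (log_deriv g has_real_derivative deriv (log_deriv g) x) (at x)"
  shows "\<forall>\<^sub>F x in at_top. deriv (log_deriv (\<lambda>x. g (ln x))) x
           = x powr (-2) * (deriv (log_deriv g) (ln x) - log_deriv g (ln x))"
proof -
  have 1: "\<forall>\<^sub>F x in at_top. log_deriv (\<lambda>x. g (ln x)) x = log_deriv g (ln x) / x"
    using eventually_compose_filterlim[OF g ln_at_top] eventually_gt_at_top[of 0]
  proof eventually_elim
    case (elim x)
    have "deriv (\<lambda>x. g (ln x)) x = deriv g (ln x) * (1 / x)"
      by (rule DERIV_imp_deriv, rule DERIV_chain2[where g = ln, OF elim(1)]) (use elim(2) in \<open>auto intro!: derivative_eq_intros\<close>)
    then show ?case by (simp add: log_deriv_def)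
  qed
  have "\<forall>\<^sub>F x in at_top. ((\<lambda>x. log_deriv g (ln x) / x) has_real_derivative
          x powr (-2) * (deriv (log_deriv g) (ln x) - log_deriv g (ln x))) (at x)"
    using eventually_compose_filterlim[OF lg ln_at_top] eventually_gt_at_top[of 0]
  proof eventually_elim
    case (elim x)
    have "((\<lambda>x. log_deriv g (ln x)) has_real_derivative deriv (log_deriv g) (ln x) * (1 / x)) (at x)"
      by (rule DERIV_chain2[where g = ln, OF elim(1)]) (use elim(2) in \<open>auto intro!: derivative_eq_intros\<close>)
    from DERIV_divide[OF this DERIV_ident] show ?case
      using elim(2) by (simp add: powr_minus divide_simps power2_eq_square algebra_simps)
  qed
  then show ?thesis
    using eventually_has_derivative_cong[OF 1] by eventually_elim (auto intro!: DERIV_imp_deriv)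
qed

section \<open>The recursion for the ratios\<close>

text \<open>
  If \<open>1 - U\<close> is the sequence of ratios \<open>a (n - 1) * a (n + 1) / (a n)\<^sup>2\<close> of \<open>a\<close>, then, up to a shift of
  the index, \<open>1 - ratio_step_seq U\<close> is that of \<open>phi a\<close>.
\<close>

definition ratio_step :: "(real \<Rightarrow> real) \<Rightarrow> real \<Rightarrow> real" where
  "ratio_step f x = 1 - (1 - f x)\<^sup>2 * (f (x - 1) * f (x + 1) / (f x)\<^sup>2)"

definition ratio_step_seq :: "(nat \<Rightarrow> real) \<Rightarrow> nat \<Rightarrow> real" where
  "ratio_step_seq U n = 1 - (1 - U n)\<^sup>2 * (U (n - 1) * U (n + 1) / (U n)\<^sup>2)"

lemma powr_mult_symbols:
  fixes \<alpha> :: real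
  assumes G: "G \<in> symbols_ess 0" "(\<lambda>x. 1 / G x) \<in> symbols_ess 0" "\<forall>\<^sub>F x in at_top. G x \<noteq> 0"
  defines "f \<equiv> \<lambda>x. x powr (-\<alpha>) * G x"
  shows "f \<in> symbols_ess \<alpha>" "(\<lambda>x. 1 / f x) \<in> symbols_ess (-\<alpha>)" "\<forall>\<^sub>F x in at_top. f x \<noteq> 0"
proof -
  show "f \<in> symbols_ess \<alpha>"
    using symbols_ess_mult[OF symbols_subset_ess[OF symbols_powr[of "-\<alpha>"]] G(1)] by (simp add: f_def)
  have "(\<lambda>x. x powr \<alpha> * (1 / G x)) \<in> symbols_ess (-\<alpha>)"
    using symbols_ess_mult[OF symbols_subset_ess[OF symbols_powr[of \<alpha>]] G(2)] by simp
  then show "(\<lambda>x. 1 / f x) \<in> symbols_ess (-\<alpha>)"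
    by (simp add: f_def powr_minus field_simps)
  show "\<forall>\<^sub>F x in at_top. f x \<noteq> 0"
    using G(3) eventually_gt_at_top[of 0] by eventually_elim (auto simp: f_def)
qed

text \<open>With \<open>w\<close> the quotient minus 1, the step equals 2 f - w - f^2 + (2 f - f^2)
  w. Up to small losses f^2 has order 2 \<alpha> and the last term order \<alpha> + 2, so only 2 f -
  w matters. As \<alpha> \<le> 2, the error \<open>E\<close> of order 3 and the effect
  \<open>K\<close> of \<open>h\<close>, of order better than 2, are negligible as well.\<close>

lemma ratio_step_expansion:
  assumes \<alpha>: "0 < \<alpha>" "\<alpha> \<le> 2"
    and G: "G \<in> symbols_ess 0" "(\<lambda>x. 1 / G x) \<in> symbols_ess 0" "\<forall>\<^sub>F x in at_top. G x \<noteq> 0"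
    and h: "h \<in> symbols_sub 0"
  defines "f \<equiv> \<lambda>x. x powr (-\<alpha>) * (G x + h x)"
  shows "(\<lambda>x. ratio_step f x - (2 * (x powr (-\<alpha>) * G x) - (x powr (-2) * \<alpha> + deriv (log_deriv G) x)))
           \<in> symbols_sub \<alpha>"
proof -
  let ?F = "\<lambda>x. G x + h x"
  have F: "?F \<in> symbols_ess 0" "(\<lambda>x. 1 / ?F x) \<in> symbols_ess 0" "\<forall>\<^sub>F x in at_top. ?F x \<noteq> 0"
    using perturbation_inverse[OF G(2,3) h] G(1) h by (auto intro: symbols_ess_add symbols_sub_imp_ess)
  have f: "f \<in> symbols_ess \<alpha>" "(\<lambda>x. 1 / f x) \<in> symbols_ess (-\<alpha>)" "\<forall>\<^sub>F x in at_top. f x \<noteq> 0"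
    using powr_mult_symbols[OF F, of \<alpha>] by (simp_all only: f_def)
  define w where "w = (\<lambda>x. f (x - 1) * f (x + 1) / (f x)\<^sup>2 - 1)"
  define E where "E = (\<lambda>x. w x - deriv (log_deriv f) x)"
  define K where "K = (\<lambda>x. deriv (log_deriv ?F) x - deriv (log_deriv G) x)"
  have E: "E \<in> symbols_ess 3"
    unfolding E_def w_def by (rule second_difference_ratio[OF f])
  have K: "K \<in> symbols_sub 2"
    unfolding K_def by (rule log_deriv_perturbation[OF G h])
  have "log_deriv f \<in> symbols_ess 1" using f by (intro symbols_ess_log_deriv)
  from symbols_ess_deriv[OF this] have "deriv (log_deriv f) \<in> symbols_ess 2" by simp
  with E have "(\<lambda>x. E x + deriv (log_deriv f) x) \<in> symbols_ess 2"
    by (intro symbols_ess_add) (auto elim: symbols_ess_mono)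
  then have w: "w \<in> symbols_ess 2" by (simp add: E_def)
  have "(\<lambda>x. 2 * (x powr (-\<alpha>) * h x)) \<in> symbols_sub \<alpha>"
    using symbols_sub_cmult[OF symbols_sub_mult[OF h symbols_subset_ess[OF symbols_powr[of "-\<alpha>"]]], of 2]
    by (simp add: mult_ac)
  moreover have "E \<in> symbols_sub \<alpha>" "K \<in> symbols_sub \<alpha>"
    using \<alpha> by (auto intro: symbols_ess_imp_sub[OF E] symbols_sub_mono[OF K])
  moreover have ff: "(\<lambda>x. f x * f x) \<in> symbols_sub \<alpha>"
    using \<alpha> by (intro symbols_ess_imp_sub[OF symbols_ess_mult[OF f(1) f(1)]]) auto
  moreover have "(\<lambda>x. (2 * f x - f x * f x) * w x) \<in> symbols_sub \<alpha>"
  proof (rule symbols_ess_imp_sub)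
    show "(\<lambda>x. (2 * f x - f x * f x) * w x) \<in> symbols_ess (\<alpha> + 2)"
      by (intro symbols_ess_mult symbols_ess_diff symbols_ess_cmult f w symbols_sub_imp_ess ff)
  qed simp
  ultimately have *: "(\<lambda>x. 2 * (x powr (-\<alpha>) * h x) - (E x + K x) - f x * f x
       + (2 * f x - f x * f x) * w x) \<in> symbols_sub \<alpha>"
    by (intro symbols_sub_add symbols_sub_diff)
  show ?thesis
  proof (rule symbols_sub_cong[OF *])
    show "\<forall>\<^sub>F x in at_top. 2 * (x powr (-\<alpha>) * h x) - (E x + K x) - f x * f x
       + (2 * f x - f x * f x) * w x =
       ratio_step f x - (2 * (x powr (-\<alpha>) * G x) - (x powr (-2) * \<alpha> + deriv (log_deriv G) x))"
      using deriv_log_deriv_powr_mult[OF F, of \<alpha>, folded f_def]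
    proof eventually_elim
      case (elim x)
      have 1: "f (x - 1) * f (x + 1) / (f x)\<^sup>2 = 1 + w x" by (simp add: w_def)
      have 2: "w x = E x + (x powr (-2) * \<alpha> + K x + deriv (log_deriv G) x)"
        using elim by (simp add: E_def K_def)
      have 3: "f x = x powr (-\<alpha>) * G x + x powr (-\<alpha>) * h x" by (simp add: f_def algebra_simps)
      have "ratio_step f x = 2 * f x - w x - f x * f x + (2 * f x - f x * f x) * w x"
        unfolding ratio_step_def 1 by algebra
      then show ?case using 2 3 by (simp add: algebra_simps)
    qed
  qed
qed

section \<open>Effect of an error term in the sequence\<close>

lemma bigo_seq_shift:
  assumes "e \<in> O(\<lambda>n::nat. real n powr p)"
  shows "(\<lambda>n. e (n + 1)) \<in> O(\<lambda>n. real n powr p)" "(\<lambda>n. e (n - 1)) \<in> O(\<lambda>n. real n powr p)"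
proof -
  have "filterlim (\<lambda>n::nat. n + 1) at_top at_top" by (rule filterlim_add_const_nat_at_top)
  from landau_o.big.compose[OF assms this]
  have "(\<lambda>n. e (n + 1)) \<in> O(\<lambda>n. real (n + 1) powr p)" .
  also have "(\<lambda>n::nat. real (n + 1) powr p) \<in> O(\<lambda>n. real n powr p)" by real_asymp
  finally show "(\<lambda>n. e (n + 1)) \<in> O(\<lambda>n. real n powr p)" .
  have "filterlim (\<lambda>n::nat. n - 1) at_top at_top" by (rule filterlim_minus_const_nat_at_top)
  from landau_o.big.compose[OF assms this]
  have "(\<lambda>n. e (n - 1)) \<in> O(\<lambda>n. real (n - 1) powr p)" .
  \<comment> \<open>Truncated subtraction agrees with real subtraction except at n = 0.\<close>
  also have "\<forall>\<^sub>F n::nat in at_top. real (n - 1) powr p = (real n - 1) powr p"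
    using eventually_ge_at_top[of 1] by eventually_elim (simp add: of_nat_diff)
  then have "(\<lambda>n::nat. real (n - 1) powr p) \<in> \<Theta>(\<lambda>n. (real n - 1) powr p)"
    by (rule bigthetaI_cong)
  also have "(\<lambda>n::nat. (real n - 1) powr p) \<in> O(\<lambda>n. real n powr p)" by real_asymp
  finally show "(\<lambda>n. e (n - 1)) \<in> O(\<lambda>n. real n powr p)" .
qed

lemma symbols_ess_bigo_seq:
  assumes "f \<in> symbols_ess a" "b < a"
  shows "(\<lambda>n. f (real n)) \<in> O(\<lambda>n. real n powr (-b))"
  using symbols_bigo[of f b] assms landau_o.big.compose[OF _ filterlim_real_sequentially]
  by (auto simp: symbols_ess_def)

text \<open>In relative form U = f (1 + \<eta>) with \<eta> = e / f. Dividing by f costs slightly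
  more than n powr \<alpha>, for which \<kappa> < \<gamma> - \<alpha> leaves room; the quotient of
  neighbouring terms then changes by a relative error of the size of \<eta>.\<close>

lemma ratio_step_perturbation:
  assumes f: "f \<in> symbols_ess \<alpha>" "(\<lambda>x. 1 / f x) \<in> symbols_ess (-\<alpha>)" "\<forall>\<^sub>F x in at_top. f x \<noteq> 0"
    and U: "\<forall>\<^sub>F n in sequentially. U n = f (real n) + e n"
    and e: "e \<in> O(\<lambda>n. real n powr (-\<gamma>))"
    and "0 < \<alpha>" "0 < \<kappa>" "\<kappa> < \<gamma> - \<alpha>"
  shows "(\<lambda>n. ratio_step_seq U n - ratio_step f (real n)) \<in> O(\<lambda>n. real n powr (-\<kappa>))"
proof -
  define \<eta> where "\<eta> = (\<lambda>n. e n * (1 / f (real n)))"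
  define v where "v = (\<lambda>n::nat. f (real n - 1) * f (real n + 1) / (f (real n))\<^sup>2)"
  \<comment> \<open>Chosen so that (1 + \<eta> (n - 1)) (1 + \<eta> (n + 1)) / (1 + \<eta> n)^2 = 1
    + \<rho> n.\<close>
  define \<rho> where "\<rho> = (\<lambda>n. (\<eta> (n - 1) + \<eta> (n + 1) + \<eta> (n - 1) * \<eta> (n + 1) - 2 * \<eta> n - \<eta> n * \<eta> n)
      * (1 / (1 + \<eta> n) * (1 / (1 + \<eta> n))))"
  let ?R = "\<lambda>n::nat. real n powr (-\<kappa>)"
  have R1: "?R \<in> O(\<lambda>_. 1)" using assms by real_asymp
  have to1: "g \<in> O(\<lambda>_. 1)" if "g \<in> O(?R)" for g using that R1 by (rule landau_o.big_trans)
  have m1: "(\<lambda>n. g n * h n) \<in> O(?R)" if "g \<in> O(\<lambda>_. 1)" "h \<in> O(?R)" for g h :: "nat \<Rightarrow> real"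
    using landau_o.big.mult[OF that] by simp
  have m2: "(\<lambda>n. g n * h n) \<in> O(\<lambda>_. 1)" if "g \<in> O(\<lambda>_. 1)" "h \<in> O(\<lambda>_. 1)" for g h :: "nat \<Rightarrow> real"
    using landau_o.big.mult[OF that] by simp
  have "(\<lambda>n::nat. real n powr (-\<gamma>)) \<in> O(?R)" using assms by real_asymp
  with e have eR: "e \<in> O(?R)" by (rule landau_o.big_trans)
  \<comment> \<open>The order \<kappa> - \<gamma> is strictly below -\<alpha>, which absorbs the
    logarithms, and the product with \<open>e\<close> becomes exactly O(n powr (-\<kappa>)).\<close>
  have "(\<lambda>n. 1 / f (real n)) \<in> O(\<lambda>n. real n powr (-(\<kappa> - \<gamma>)))"
    using symbols_ess_bigo_seq[OF f(2), of "\<kappa> - \<gamma>"] assms by simp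
  from landau_o.big.mult[OF e this] have \<eta>: "\<eta> \<in> O(?R)"
    by (simp add: \<eta>_def flip: powr_add)
  have f1: "(\<lambda>n. f (real n)) \<in> O(\<lambda>n. 1)"
    using symbols_ess_bigo_seq[OF f(1), of 0] assms
    by (auto elim!: landau_o.big.ev_eq_trans2 intro: eventually_mono[OF eventually_gt_at_top[of 0]])
  have "(\<lambda>x. f (x - 1) * f (x + 1) / (f x)\<^sup>2 - 1) \<in> symbols_ess 2"
  proof -
    have "log_deriv f \<in> symbols_ess 1" using f by (intro symbols_ess_log_deriv)
    from symbols_ess_deriv[OF this] have "deriv (log_deriv f) \<in> symbols_ess 2" by simp
    with second_difference_ratio[OF f]
    have "(\<lambda>x. (f (x - 1) * f (x + 1) / (f x)\<^sup>2 - 1 - deriv (log_deriv f) x) + deriv (log_deriv f) x) \<in> symbols_ess 2"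
      by (intro symbols_ess_add) (auto elim: symbols_ess_mono)
    then show ?thesis by simp
  qed
  from symbols_ess_bigo_seq[OF this, of 1]
  have "(\<lambda>n. v n - 1) \<in> O(\<lambda>n. real n powr (-1))" by (simp add: v_def)
  also have "(\<lambda>n. real n powr (-1)) \<in> O(\<lambda>n. 1)" by real_asymp
  finally have "(\<lambda>n. (v n - 1) + 1) \<in> O(\<lambda>n. 1)" by (rule sum_in_bigo(1)) simp
  then have v: "v \<in> O(\<lambda>n. 1)" by (simp only: diff_add_cancel)
  have \<eta>0: "\<eta> \<longlonglongrightarrow> 0"
  proof -
    have "?R \<in> o(\<lambda>_. 1)" using assms by real_asymp
    with \<eta> have "\<eta> \<in> o(\<lambda>_. 1)" by (rule landau_o.big_small_trans)
    then show ?thesis by (auto dest: smalloD_tendsto)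
  qed
  have "(\<lambda>n. 1 / (1 + \<eta> n)) \<longlonglongrightarrow> 1 / (1 + 0)"
    by (intro tendsto_intros \<eta>0) simp
  then have i1: "(\<lambda>n. 1 / (1 + \<eta> n)) \<in> O(\<lambda>_. 1)"
    by (intro bigoI_tendsto[of _ _ 1]) auto
  have "\<rho> \<in> O(?R)"
  proof -
    note s = bigo_seq_shift[OF \<eta>]
    have "(\<lambda>n. \<eta> (n - 1) + \<eta> (n + 1) + \<eta> (n - 1) * \<eta> (n + 1) - 2 * \<eta> n - \<eta> n * \<eta> n) \<in> O(?R)"
      by (intro sum_in_bigo m1 to1[OF s(2)] to1[OF \<eta>] s \<eta>) (use \<eta> in simp)
    from m1[OF m2[OF i1 i1] this] show ?thesis by (simp add: \<rho>_def mult_ac)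
  qed
  note \<rho> = this
  \<comment> \<open>The difference of the two steps, split into the change of the quotient, with
    factor \<rho>, and that of the square of 1 - U n, with factor e; all other factors are
    bounded.\<close>
  have *: "(\<lambda>n. - ((1 - f (real n)) * (1 - f (real n)) * v n * \<rho> n
         + v n * (1 + \<rho> n) * (e n - 2 * (1 - f (real n))) * e n)) \<in> O(?R)"
  proof -
    have c: "(\<lambda>_. k) \<in> O(\<lambda>_::nat. 1)" for k :: real by simp
    have "(\<lambda>n. (1 - f (real n)) * (1 - f (real n)) * v n * \<rho> n
         + v n * (1 + \<rho> n) * (e n - 2 * (1 - f (real n))) * e n) \<in> O(?R)"
      by (intro sum_in_bigo m1[OF _ \<rho>] m1[OF _ eR] m2 v c f1 to1[OF eR] to1[OF \<rho>])
    then show ?thesis by (simp only: landau_o.big.uminus_in_iff)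
  qed
  have ev1: "\<forall>\<^sub>F n in sequentially. U n = f (real n) * (1 + \<eta> n) \<and> U n = f (real n) + e n \<and> f (real n) \<noteq> 0"
    using U eventually_compose_filterlim[OF f(3) filterlim_real_sequentially]
    by eventually_elim (auto simp: \<eta>_def field_simps)
  have \<eta>m1: "\<forall>\<^sub>F n in sequentially. -1 < \<eta> n"
    by (rule order_tendstoD(1)[OF \<eta>0]) simp
  have "\<forall>\<^sub>F n in sequentially. - ((1 - f (real n)) * (1 - f (real n)) * v n * \<rho> n
         + v n * (1 + \<rho> n) * (e n - 2 * (1 - f (real n))) * e n) =
       ratio_step_seq U n - ratio_step f (real n)"
    using ev1 eventually_compose_filterlim[OF ev1 filterlim_minus_const_nat_at_top[of 1]]
      eventually_compose_filterlim[OF ev1 filterlim_add_const_nat_at_top[of 1]]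
      \<eta>m1 eventually_ge_at_top[of 1]
  proof eventually_elim
    case (elim n)
    define A B C where "A = \<eta> (n - 1)" and "B = \<eta> n" and "C = \<eta> (n + 1)"
    have B: "1 + B \<noteq> 0" using elim by (auto simp: B_def)
    have r: "real (n - 1) = real n - 1" "real (n + 1) = real n + 1" using elim by auto
    have "\<rho> n = (A + C + A * C - 2 * B - B * B) / (1 + B)\<^sup>2"
      unfolding \<rho>_def by (simp add: A_def B_def C_def power2_eq_square)
    also have "\<dots> = ((1 + A) * (1 + C) - (1 + B)\<^sup>2) / (1 + B)\<^sup>2"
      by (rule arg_cong2[where f = "(/)", OF _ refl]) algebra
    also have "\<dots> = (1 + A) * (1 + C) / (1 + B)\<^sup>2 - 1"
      using B by (simp add: diff_divide_distrib)
    finally have \<rho>n: "(1 + A) * (1 + C) / (1 + B)\<^sup>2 = 1 + \<rho> n" by simp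
    have "U (n - 1) = f (real n - 1) * (1 + A)" "U (n + 1) = f (real n + 1) * (1 + C)"
         "U n = f (real n) * (1 + B)"
      using elim unfolding A_def B_def C_def r by auto
    then have "U (n - 1) * U (n + 1) / (U n)\<^sup>2 = v n * ((1 + A) * (1 + C) / (1 + B)\<^sup>2)"
      by (simp add: v_def power_mult_distrib mult_ac)
    also have "\<dots> = v n * (1 + \<rho> n)" unfolding \<rho>n ..
    finally have 1: "U (n - 1) * U (n + 1) / (U n)\<^sup>2 = v n * (1 + \<rho> n)" .
    have 2: "U n = f (real n) + e n" using elim by auto
    have "ratio_step_seq U n - ratio_step f (real n) =
       (1 - f (real n))\<^sup>2 * v n - (1 - U n)\<^sup>2 * (v n * (1 + \<rho> n))"
      unfolding ratio_step_seq_def ratio_step_def 1 by (simp add: v_def)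
    then show ?case unfolding 2 by algebra
  qed
  from * landau_o.big.in_cong[OF this] show ?thesis by blast
qed

section \<open>Expansions with a logarithmic leading coefficient\<close>

text \<open>As for elliptic symbols in analysis, a lower bound by the same power makes 1 / g a
  symbol of the opposite order. Here \<open>t\<close> is a growth exponent, so \<open>g\<close> has
  order -t; the variable stands for ln x.\<close>

definition elliptic :: "real \<Rightarrow> (real \<Rightarrow> real) \<Rightarrow> bool" where
  "elliptic t g \<longleftrightarrow> g \<in> symbols (-t) \<and> (\<exists>c>0. \<forall>\<^sub>F y in at_top. g y \<ge> c * y powr t)"

lemma elliptic_pos:
  assumes "elliptic t g"
  shows "\<forall>\<^sub>F y in at_top. g y > 0"
proof -
  obtain c where c: "c > 0" "\<forall>\<^sub>F y in at_top. g y \<ge> c * y powr t"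
    using assms by (auto simp: elliptic_def)
  show ?thesis using c(2) eventually_gt_at_top[of 0]
  proof eventually_elim
    case (elim y)
    have "0 < c * y powr t" using c(1) elim by simp
    then show ?case using elim(1) by linarith
  qed
qed

lemma elliptic_inverse:
  assumes "elliptic t g"
  shows "(\<lambda>y. 1 / g y) \<in> symbols t"
proof -
  obtain c where c: "c > 0" "\<forall>\<^sub>F y in at_top. g y \<ge> c * y powr t"
    using assms by (auto simp: elliptic_def)
  have "\<forall>\<^sub>F y in at_top. \<bar>g y\<bar> \<ge> c * y powr (-(-t))"
    using c(2) by eventually_elim simp
  from symbols_inverse[OF _ c(1) this] assms show ?thesis by (simp add: elliptic_def)
qed

lemma symbols_ess_comp_ln:
  assumes "g \<in> symbols p"
  shows "(\<lambda>x. g (ln x)) \<in> symbols_ess 0"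
  using symbols_comp_ln[OF assms, of "- _"] by (auto simp: symbols_ess_def)

lemma elliptic_comp_ln:
  assumes "elliptic t g"
  shows "(\<lambda>x. g (ln x)) \<in> symbols_ess 0" "(\<lambda>x. 1 / g (ln x)) \<in> symbols_ess 0"
    "\<forall>\<^sub>F x in at_top. g (ln x) \<noteq> 0"
  using symbols_ess_comp_ln[OF elliptic_inverse[OF assms]] assms
    eventually_compose_filterlim[OF elliptic_pos[OF assms] ln_at_top]
  by (auto simp: elliptic_def intro: symbols_ess_comp_ln elim: eventually_mono)

lemma elliptic_cmult:
  assumes "elliptic t g" "k > 0"
  shows "elliptic t (\<lambda>y. k * g y)"
proof -
  obtain c where c: "c > 0" "\<forall>\<^sub>F y in at_top. g y \<ge> c * y powr t"
    using assms by (auto simp: elliptic_def)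
  have "\<forall>\<^sub>F y in at_top. k * g y \<ge> (k * c) * y powr t"
    using c(2) by eventually_elim (use assms(2) in \<open>simp add: mult.assoc\<close>)
  moreover have "k * c > 0" using c(1) assms(2) by simp
  ultimately show ?thesis
    using assms by (auto simp: elliptic_def intro: symbols_cmult)
qed

text \<open>\<open>q\<close> is o(y powr t), so it takes away at most half of the constant in the
  lower bound.\<close>

lemma elliptic_add_lower:
  assumes g: "elliptic t g" and q: "q \<in> symbols p" and "p > -t"
  shows "elliptic t (\<lambda>y. g y + q y)"
proof -
  obtain c where c: "c > 0" "\<forall>\<^sub>F y in at_top. g y \<ge> c * y powr t"
    using g by (auto simp: elliptic_def)
  have "q \<in> O(\<lambda>y. y powr (-p))" using symbols_bigo[OF q] .
  also have "(\<lambda>y. y powr (-p)) \<in> o(\<lambda>y::real. y powr t)"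
    using assms(3) by (subst powr_smallo_iff[OF filterlim_ident]) auto
  finally have "\<forall>\<^sub>F y in at_top. norm (q y) \<le> c / 2 * norm (y powr t)"
    using c(1) by (auto dest: landau_o.smallD[where c = "c / 2"])
  then have "\<forall>\<^sub>F y in at_top. g y + q y \<ge> c / 2 * y powr t"
    using c(2) by eventually_elim (auto simp: abs_le_iff)
  moreover have "(\<lambda>y. g y + q y) \<in> symbols (-t)"
    using g q assms(3) by (intro symbols_add) (auto simp: elliptic_def intro: symbols_mono)
  ultimately show ?thesis using c(1) by (auto simp: elliptic_def intro!: exI[of _ "c / 2"])
qed

text \<open>The dominant one of two positive summands supplies the lower bound: \<open>g\<close> if
  t \<ge> 0, the constant if t < 0.\<close>

lemma elliptic_add_const:
  assumes g: "elliptic t g" and "k > 0"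
  shows "elliptic (max t 0) (\<lambda>y. g y + k)"
proof -
  obtain c where c: "c > 0" "\<forall>\<^sub>F y in at_top. g y \<ge> c * y powr t"
    using g by (auto simp: elliptic_def)
  have "\<forall>\<^sub>F y in at_top. g y + k \<ge> min c k * y powr max t 0"
    using c(2) elliptic_pos[OF g] eventually_gt_at_top[of 0]
  proof eventually_elim
    case (elim y)
    show ?case
    proof (cases "t \<ge> 0")
      case True
      then have "min c k * y powr max t 0 \<le> c * y powr t" by (auto intro: mult_right_mono)
      then show ?thesis using elim assms(2) by linarith
    next
      case False
      then show ?thesis using elim by simp
    qed
  qed
  moreover have "(\<lambda>y. g y + k) \<in> symbols (- max t 0)"
    by (rule symbols_add; rule symbols_mono) (use g symbols_const in \<open>auto simp: elliptic_def\<close>)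
  moreover have "min c k > 0" using c(1) assms(2) by simp
  ultimately show ?thesis unfolding elliptic_def by blast
qed

text \<open>With L = ln g this is L'' - L', the coefficient of x powr (-2) in the second derivative
  of ln (g (ln x)).\<close>

definition curvature :: "(real \<Rightarrow> real) \<Rightarrow> real \<Rightarrow> real" where
  "curvature g y = deriv (log_deriv g) y - log_deriv g y"

lemma log_deriv_symbols:
  assumes "deriv g \<in> symbols p" "(\<lambda>y. 1 / g y) \<in> symbols q"
  shows "log_deriv g \<in> symbols (p + q)"
  using symbols_mult[OF assms] by (simp add: log_deriv_def [abs_def])

lemma curvature_symbols:
  assumes "log_deriv g \<in> symbols p"
  shows "curvature g \<in> symbols p"
  using symbols_diff[OF symbols_mono[OF symbols_deriv[OF assms]] assms]
  by (simp add: curvature_def [abs_def])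

text \<open>Two kinds of corrections: \<open>h\<close> has controlled derivatives, so its finite
  differences gain powers; of \<open>e\<close> only the size is known.\<close>

definition log_expansion :: "real \<Rightarrow> (real \<Rightarrow> real) \<Rightarrow> real \<Rightarrow> (nat \<Rightarrow> real) \<Rightarrow> bool" where
  "log_expansion \<alpha> g \<gamma> U \<longleftrightarrow> (\<exists>h\<in>symbols_sub 0. \<exists>e\<in>O(\<lambda>n. real n powr (-\<gamma>)).
     \<forall>\<^sub>F n in sequentially. U n = real n powr (-\<alpha>) * (g (ln (real n)) + h (real n)) + e n)"

text \<open>Dividing by the leading term leaves 1 + h / g + (e / g) n powr \<alpha>, and both
  corrections tend to 0 because a power beats the logarithms in 1 / g.\<close>

lemma log_expansion_pos:
  assumes U: "log_expansion \<alpha> g \<gamma> U" and g: "elliptic t g" and "\<alpha> < \<gamma>"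
  shows "\<forall>\<^sub>F n in sequentially. U n > 0"
proof -
  obtain h e where h: "h \<in> symbols_sub 0" and e: "e \<in> O(\<lambda>n. real n powr (-\<gamma>))"
    and U: "\<forall>\<^sub>F n in sequentially. U n = real n powr (-\<alpha>) * (g (ln (real n)) + h (real n)) + e n"
    using U by (auto simp: log_expansion_def)
  have "(\<lambda>x. h x * (1 / g (ln x))) \<in> symbols_sub 0"
    using symbols_sub_mult[OF h elliptic_comp_ln(2)[OF g]] by simp
  from filterlim_compose[OF symbols_sub_tendsto_0[OF this] filterlim_real_sequentially]
  have 1: "(\<lambda>n. h (real n) * (1 / g (ln (real n)))) \<longlonglongrightarrow> 0" .
  \<comment> \<open>Half of the gap \<gamma> - \<alpha> pays for 1 / g; the other half makes the
    product tend to 0.\<close>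
  have "(\<lambda>n. 1 / g (ln (real n))) \<in> O(\<lambda>n. real n powr (-((\<alpha> - \<gamma>) / 2)))"
    using symbols_ess_bigo_seq[OF elliptic_comp_ln(2)[OF g], of "(\<alpha> - \<gamma>) / 2"] assms(3) by simp
  from landau_o.big.mult[OF landau_o.big.mult[OF e this], of "\<lambda>n. real n powr \<alpha>" "\<lambda>n. real n powr \<alpha>"]
  have "(\<lambda>n. e n * (1 / g (ln (real n))) * real n powr \<alpha>) \<in>
      O(\<lambda>n. real n powr (-\<gamma>) * real n powr (-((\<alpha> - \<gamma>) / 2)) * real n powr \<alpha>)" by simp
  also have "(\<lambda>n. real n powr (-\<gamma>) * real n powr (-((\<alpha> - \<gamma>) / 2)) * real n powr \<alpha>) \<in> o(\<lambda>_. 1)"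
  proof -
    have "-\<gamma> + -((\<alpha> - \<gamma>) / 2) + \<alpha> = (\<alpha> - \<gamma>) / 2" by (simp add: field_simps)
    moreover have "(\<lambda>n. real n powr ((\<alpha> - \<gamma>) / 2)) \<in> o(\<lambda>n. real n powr 0)"
      using assms(3) by (subst powr_smallo_iff[OF filterlim_real_sequentially]) auto
    then have "(\<lambda>n. real n powr ((\<alpha> - \<gamma>) / 2)) \<in> o(\<lambda>_. 1)"
      by (rule landau_o.small_big_trans) real_asymp
    ultimately show ?thesis by (simp only: powr_add[symmetric])
  qed
  finally have 2: "(\<lambda>n. e n * (1 / g (ln (real n))) * real n powr \<alpha>) \<longlonglongrightarrow> 0"
    by (auto dest: smalloD_tendsto)
  have "(\<lambda>n. 1 + h (real n) * (1 / g (ln (real n))) + e n * (1 / g (ln (real n))) * real n powr \<alpha>)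
      \<longlonglongrightarrow> 1 + 0 + 0"
    by (intro tendsto_intros 1 2)
  then have "\<forall>\<^sub>F n in sequentially. 1 + h (real n) * (1 / g (ln (real n))) + e n * (1 / g (ln (real n))) * real n powr \<alpha> > 0"
    by (rule order_tendstoD) simp
  then show ?thesis
    using U eventually_compose_filterlim[OF eventually_compose_filterlim[OF elliptic_pos[OF g] ln_at_top]
        filterlim_real_sequentially] eventually_gt_at_top[of 0]
  proof eventually_elim
    case (elim n)
    have "U n = real n powr (-\<alpha>) * g (ln (real n)) *
      (1 + h (real n) * (1 / g (ln (real n))) + e n * (1 / g (ln (real n))) * real n powr \<alpha>)"
    proof -
      have "g (ln (real n)) * (1 / g (ln (real n))) = 1" using elim(3) by simp
      moreover have "real n powr (-\<alpha>) * real n powr \<alpha> = 1" using elim(4) by (simp add: powr_minus)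
      ultimately show ?thesis unfolding elim(2) by algebra
    qed
    then show ?case using elim by simp
  qed
qed

text \<open>
  Dividing by \<open>U\<close> costs a factor \<open>real n powr \<alpha>\<close>, up to logarithms, in the error term.
\<close>

lemma log_expansion_ratio_step:
  assumes U: "log_expansion \<alpha> g \<gamma> U" and g: "elliptic t g" and \<alpha>: "0 < \<alpha>" "\<alpha> \<le> 2"
    and \<kappa>: "0 < \<kappa>" "\<kappa> < \<gamma> - \<alpha>"
    and g': "(\<lambda>x. 2 * (x powr (-\<alpha>) * g (ln x)) - x powr (-2) * (\<alpha> + curvature g (ln x))
               - x powr (-\<alpha>) * g' (ln x)) \<in> symbols_sub \<alpha>"
  shows "log_expansion \<alpha> g' \<kappa> (ratio_step_seq U)"
proof -
  obtain h e where h: "h \<in> symbols_sub 0" and e: "e \<in> O(\<lambda>n. real n powr (-\<gamma>))"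
    and U: "\<forall>\<^sub>F n in sequentially. U n = real n powr (-\<alpha>) * (g (ln (real n)) + h (real n)) + e n"
    using U by (auto simp: log_expansion_def)
  note G = elliptic_comp_ln[OF g]
  let ?F = "\<lambda>x. g (ln x) + h x"
  define f where "f = (\<lambda>x. x powr (-\<alpha>) * ?F x)"
  have F: "?F \<in> symbols_ess 0" "(\<lambda>x. 1 / ?F x) \<in> symbols_ess 0" "\<forall>\<^sub>F x in at_top. ?F x \<noteq> 0"
    using perturbation_inverse[OF G(2,3) h] G(1) h by (auto intro: symbols_ess_add symbols_sub_imp_ess)
  have f: "f \<in> symbols_ess \<alpha>" "(\<lambda>x. 1 / f x) \<in> symbols_ess (-\<alpha>)" "\<forall>\<^sub>F x in at_top. f x \<noteq> 0"
    using powr_mult_symbols[OF F, of \<alpha>] by (simp_all only: f_def)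
  have e': "(\<lambda>n. ratio_step_seq U n - ratio_step f (real n)) \<in> O(\<lambda>n. real n powr (-\<kappa>))"
    by (rule ratio_step_perturbation[OF f _ e \<alpha>(1) \<kappa>]) (use U in \<open>simp add: f_def\<close>)
  have gd: "g \<in> symbols (-t)" using g by (simp add: elliptic_def)
  have "log_deriv g \<in> symbols (-t + 1 + t)"
    by (rule log_deriv_symbols[OF symbols_deriv[OF gd] elliptic_inverse[OF g]])
  from deriv_log_deriv_comp_ln[OF symbols_has_deriv[OF gd] symbols_has_deriv[OF this]]
  have ev: "\<forall>\<^sub>F x in at_top. deriv (log_deriv (\<lambda>x. g (ln x))) x = x powr (-2) * curvature g (ln x)"
    by (simp add: curvature_def)
  define D where "D = (\<lambda>x. ratio_step f x - x powr (-\<alpha>) * g' (ln x))"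
  \<comment> \<open>Adding the expansion of \<open>ratio_step f\<close> and the hypothesis on
    \<open>g'\<close> cancels the terms with \<open>g\<close> and its curvature.\<close>
  have D: "D \<in> symbols_sub \<alpha>"
    by (rule symbols_sub_cong[OF symbols_sub_add[OF ratio_step_expansion[OF \<alpha> G h, folded f_def] g']],
        use ev in eventually_elim) (simp add: D_def algebra_simps)
  define h' where "h' = (\<lambda>x. D x * x powr \<alpha>)"
  have h': "h' \<in> symbols_sub 0"
    using symbols_sub_mult[OF D symbols_subset_ess[OF symbols_powr[of \<alpha>]]] by (simp add: h'_def)
  have "\<forall>\<^sub>F n in sequentially. ratio_step_seq U n = real n powr (-\<alpha>) * (g' (ln (real n)) + h' (real n))
      + (ratio_step_seq U n - ratio_step f (real n))"
    using eventually_gt_at_top[of 0]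
  proof eventually_elim
    case (elim n)
    then have "real n powr (-\<alpha>) * real n powr \<alpha> = 1" by (simp add: powr_minus)
    then show ?case unfolding h'_def D_def by algebra
  qed
  then show ?thesis unfolding log_expansion_def by (rule bexI[OF bexI[OF _ e'] h'])
qed

text \<open>An error budget: after k steps the error exponent still exceeds (l - k) \<alpha>, since
  each step uses up \<alpha> plus an arbitrarily small amount. For k < l it exceeds \<alpha>, as
  positivity requires.\<close>

lemma iterated_ratio_step_pos:
  assumes \<alpha>: "0 < \<alpha>" "\<alpha> \<le> 2" and U: "log_expansion \<alpha> (g 0) \<gamma> U" and \<gamma>: "\<gamma> > real l * \<alpha>"
    and g: "\<And>k. k < l \<Longrightarrow> elliptic (t k) (g k)"
    and step: "\<And>k. Suc k < l \<Longrightarrow>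
       (\<lambda>x. 2 * (x powr (-\<alpha>) * g k (ln x)) - x powr (-2) * (\<alpha> + curvature (g k) (ln x))
               - x powr (-\<alpha>) * g (Suc k) (ln x)) \<in> symbols_sub \<alpha>"
    and k: "k < l"
  shows "\<forall>\<^sub>F n in sequentially. (ratio_step_seq ^^ k) U n > 0"
proof -
  have "\<exists>\<delta>>(real l - real k) * \<alpha>. log_expansion \<alpha> (g k) \<delta> ((ratio_step_seq ^^ k) U)"
    using k
  proof (induction k)
    case 0
    then show ?case using U \<gamma> by auto
  next
    case (Suc k)
    then obtain \<delta> where \<delta>: "\<delta> > (real l - real k) * \<alpha>"
        "log_expansion \<alpha> (g k) \<delta> ((ratio_step_seq ^^ k) U)" by auto
    \<comment> \<open>The strict bound on \<delta> leaves an interval for the small extra loss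
      beyond \<alpha>.\<close>
    obtain \<kappa> where \<kappa>: "(real l - real (Suc k)) * \<alpha> < \<kappa>" "\<kappa> < \<delta> - \<alpha>"
      using dense[of "(real l - real (Suc k)) * \<alpha>" "\<delta> - \<alpha>"] \<delta>(1) by (auto simp: algebra_simps)
    have "(real l - real (Suc k)) * \<alpha> \<ge> 0" using Suc.prems \<alpha> by (intro mult_nonneg_nonneg) auto
    then have "log_expansion \<alpha> (g (Suc k)) \<kappa> (ratio_step_seq ((ratio_step_seq ^^ k) U))"
      using Suc.prems \<kappa> by (intro log_expansion_ratio_step[OF \<delta>(2) g \<alpha> _ _ step]) auto
    then show ?case using \<kappa> by auto
  qed
  then obtain \<delta> where \<delta>: "\<delta> > (real l - real k) * \<alpha>"
      "log_expansion \<alpha> (g k) \<delta> ((ratio_step_seq ^^ k) U)" by auto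
  have "1 * \<alpha> \<le> (real l - real k) * \<alpha>" using k \<alpha> by (intro mult_right_mono) auto
  then show ?thesis using \<delta> by (intro log_expansion_pos[OF \<delta>(2) g[OF k]]) auto
qed

section \<open>Rational functions\<close>

lemma poly_ratio_tendsto_at_top:
  fixes p :: "real poly"
  shows "((\<lambda>x. poly p x / x powr real (degree p)) \<longlongrightarrow> lead_coeff p) at_top"
proof -
  have "((\<lambda>x. poly p x / x ^ degree p) \<longlongrightarrow> lead_coeff p) at_top"
    using poly_divide_tendsto_aux[of p] at_top_le_at_infinity by (rule tendsto_mono[rotated])
  then show ?thesis
    by (rule Lim_transform_eventually, use eventually_gt_at_top[of 0] in eventually_elim)
       (simp add: powr_realpow)
qed

lemma poly_symbols:
  fixes p :: "real poly"
  shows "poly p \<in> symbols (- real (degree p))"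
proof -
  have "symb J (- real (degree p)) (poly p)" for J
  proof (induction J arbitrary: p)
    have big: "poly p \<in> O(\<lambda>x. x powr (- (- real (degree p))))" for p :: "real poly"
      using poly_ratio_tendsto_at_top[of p] eventually_gt_at_top[of "0::real"]
      by (intro bigoI_tendsto[of _ _ "lead_coeff p"]) (auto elim: eventually_mono)
    {
      case 0
      show ?case using big by simp
    next
      case (Suc J)
      have "symb J (- real (degree p) + 1) (poly (pderiv p))"
      \<comment> \<open>Constants are separate: the degree cannot drop below 0, but the derivative
        vanishes.\<close>
      proof (cases "degree p = 0")
        case True
        then have "poly (pderiv p) = (\<lambda>x. 0)" by (simp add: pderiv_eq_0_iff[THEN iffD2] fun_eq_iff)
        then show ?thesis using symb_zero by simp
      next
        case False
        then show ?thesis using Suc[of "pderiv p"] by (simp add: degree_pderiv of_nat_diff)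
      qed
      then show ?case using big[of p] by (auto intro!: exI[of _ "poly (pderiv p)"] poly_DERIV)
    }
  qed
  then show ?thesis by (simp add: symbols_def)
qed

lemma poly_lower_bound:
  fixes p :: "real poly"
  assumes "p \<noteq> 0"
  shows "\<exists>c>0. \<forall>\<^sub>F x in at_top. \<bar>poly p x\<bar> \<ge> c * x powr real (degree p)"
proof (intro exI conjI)
  show c: "\<bar>lead_coeff p\<bar> / 2 > 0" using assms by simp
  have "\<forall>\<^sub>F x in at_top. \<bar>poly p x / x powr real (degree p)\<bar> > \<bar>lead_coeff p\<bar> / 2"
    by (rule order_tendstoD(1)[OF tendsto_rabs[OF poly_ratio_tendsto_at_top]]) (use c in simp)
  then show "\<forall>\<^sub>F x in at_top. \<bar>poly p x\<bar> \<ge> \<bar>lead_coeff p\<bar> / 2 * x powr real (degree p)"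
    using eventually_gt_at_top[of 0]
    by eventually_elim (simp add: abs_divide field_simps)
qed

text \<open>The denominator eventually exceeds a multiple of a power of x, so its zeros, where
  \<open>f\<close> is unconstrained, are left behind.\<close>

lemma rational_function_cases:
  assumes "rational_function f"
  obtains p q :: "real poly" where "q \<noteq> 0" "\<forall>\<^sub>F x in at_top. f x = poly p x * (1 / poly q x)"
    "(\<lambda>x. 1 / poly q x) \<in> symbols (real (degree q))"
proof -
  obtain p q :: "real poly" where pq: "q \<noteq> 0" "\<forall>x. poly q x \<noteq> 0 \<longrightarrow> f x = poly p x / poly q x"
    using assms by (auto simp: rational_function_def)
  obtain c where c: "c > 0" "\<forall>\<^sub>F x in at_top. \<bar>poly q x\<bar> \<ge> c * x powr real (degree q)"
    using poly_lower_bound[OF pq(1)] by auto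
  have "\<forall>\<^sub>F x in at_top. f x = poly p x * (1 / poly q x)"
    using c(2) eventually_gt_at_top[of 0]
  proof eventually_elim
    case (elim x)
    have "0 < c * x powr real (degree q)" using c(1) elim by simp
    with elim(1) have "poly q x \<noteq> 0" by auto
    then show ?case using pq(2) by simp
  qed
  moreover have "(\<lambda>x. 1 / poly q x) \<in> symbols (- (- real (degree q)))"
    using c by (intro symbols_inverse[OF poly_symbols]) auto
  ultimately show ?thesis using that[OF pq(1)] by simp
qed

lemma rational_function_symbols:
  assumes "rational_function f"
  shows "\<exists>p. f \<in> symbols p"
proof -
  obtain p q :: "real poly" where *: "\<forall>\<^sub>F x in at_top. f x = poly p x * (1 / poly q x)"
    "(\<lambda>x. 1 / poly q x) \<in> symbols (real (degree q))"
    using rational_function_cases[OF assms] .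
  have "\<forall>\<^sub>F x in at_top. poly p x * (1 / poly q x) = f x"
    using *(1) by eventually_elim simp
  from symbols_cong[OF symbols_mult[OF poly_symbols *(2)] this] show ?thesis by blast
qed

text \<open>Bounding the numerator below and the denominator above by their leading powers gives the
  exponent deg p - deg q. Positivity excludes p = 0 and turns the bound on absolute values into one
  on \<open>f\<close>.\<close>

lemma rational_function_elliptic:
  assumes "rational_function f" and pos: "\<forall>\<^sub>F x in at_top. f x > 0"
  shows "\<exists>t. elliptic t f"
proof -
  obtain p q :: "real poly" where q: "q \<noteq> 0" and f: "\<forall>\<^sub>F x in at_top. f x = poly p x * (1 / poly q x)"
    and q1: "(\<lambda>x. 1 / poly q x) \<in> symbols (real (degree q))"
    using rational_function_cases[OF assms(1)] .
  have "p \<noteq> 0"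
  proof
    assume "p = 0"
    with f have "\<forall>\<^sub>F x in at_top. f x = 0" by simp
    from eventually_conj[OF this pos] have "\<forall>\<^sub>F x::real in at_top. False"
      by (rule eventually_mono) auto
    then show False by simp
  qed
  then obtain c where c: "c > 0" "\<forall>\<^sub>F x in at_top. \<bar>poly p x\<bar> \<ge> c * x powr real (degree p)"
    using poly_lower_bound by blast
  have "poly q \<in> O(\<lambda>x. x powr real (degree q))" using symbols_bigo[OF poly_symbols[of q]] by simp
  then obtain d where d: "d > 0" "\<forall>\<^sub>F x in at_top. norm (poly q x) \<le> d * norm (x powr real (degree q))"
    by (elim landau_o.bigE)
  let ?t = "real (degree p) - real (degree q)"
  have "\<forall>\<^sub>F x in at_top. f x \<ge> c / d * x powr ?t"
    using f pos c(2) d(2) eventually_gt_at_top[of 0]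
  proof eventually_elim
    case (elim x)
    have nz: "poly q x \<noteq> 0" using elim(1,2) by auto
    have "c / d * x powr ?t = (c * x powr real (degree p)) / (d * x powr real (degree q))"
      by (simp add: powr_diff)
    also have "\<dots> \<le> \<bar>poly p x\<bar> / \<bar>poly q x\<bar>"
      using elim nz c(1) d(1) by (intro frac_le) auto
    also have "\<dots> = f x" using elim(1,2) by (simp flip: abs_divide)
    finally show ?case .
  qed
  moreover have "f \<in> symbols (- ?t)"
  proof (rule symbols_cong)
    show "(\<lambda>x. poly p x * (1 / poly q x)) \<in> symbols (- ?t)"
      using symbols_mult[OF poly_symbols[of p] q1] by (simp add: algebra_simps)
    show "\<forall>\<^sub>F x in at_top. poly p x * (1 / poly q x) = f x"
      using f by eventually_elim simp
  qed
  moreover have "c / d > 0" using c d by simp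
  ultimately show ?thesis unfolding elliptic_def by blast
qed

text \<open>Turns an eventual upper bound f < k into positivity of a rational function, hence into
  ellipticity.\<close>

lemma rational_function_affine:
  assumes "rational_function f"
  shows "rational_function (\<lambda>x. k - f x)"
proof -
  obtain p q :: "real poly" where pq: "q \<noteq> 0" "\<forall>x. poly q x \<noteq> 0 \<longrightarrow> f x = poly p x / poly q x"
    using assms by (auto simp: rational_function_def)
  then show ?thesis unfolding rational_function_def
    by (intro exI[of _ "smult k q - p"] exI[of _ q]) (auto simp: diff_divide_distrib)
qed

section \<open>Iterates of the log-concavity operator\<close>

lemma phi_shift: "phi (\<lambda>n. b (n + N)) = (\<lambda>n. phi b (n + N))"
proof
  fix n
  have "n + 1 + N = n + N + 1" "n + 2 + N = n + N + 2" by auto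
  then show "phi (\<lambda>n. b (n + N)) n = phi b (n + N)" unfolding phi_def by (simp only:)
qed

lemma phi_iterate_shift: "(phi ^^ k) (\<lambda>n. a (n + N)) = (\<lambda>n. (phi ^^ k) a (n + N))"
proof (induction k)
  case 0
  show ?case by (simp only: funpow.simps id_apply)
next
  case (Suc k)
  show ?case unfolding funpow.simps o_apply Suc.IH by (rule phi_shift)
qed

text \<open>If 1 - V is the ratio of the k-th iterate b, then phi b n is the square of b (n + 1)
  times V, so the ratio of phi b is the squared ratio of b times the quotient of neighbouring V: the
  recursion \<open>ratio_step_seq\<close>. Each phi moves the centre of the three terms by one,
  whence the index n + k + 1. For k = 0 only non-vanishing is claimed, as \<open>a\<close> may
  change sign.\<close>

lemma phi_iterate_ratio:
  assumes a: "\<forall>\<^sub>F n in sequentially. a n \<noteq> 0"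
    and U: "U = (\<lambda>n. 1 - a (n - 1) * a (n + 1) / (a n)\<^sup>2)"
    and pos: "\<And>j. j < k \<Longrightarrow> \<forall>\<^sub>F n in sequentially. (ratio_step_seq ^^ j) U n > 0"
  shows "\<forall>\<^sub>F n in sequentially. (phi ^^ k) a n \<noteq> 0 \<and> (k > 0 \<longrightarrow> (phi ^^ k) a n > 0) \<and>
    (phi ^^ k) a n * (phi ^^ k) a (n + 2) / ((phi ^^ k) a (n + 1))\<^sup>2 = 1 - (ratio_step_seq ^^ k) U (n + k + 1)"
  using pos
proof (induction k)
  case 0
  show ?case using a by eventually_elim (simp add: U)
next
  case (Suc k)
  define b where "b = (phi ^^ k) a"
  define V where "V = (ratio_step_seq ^^ k) U"
  have bV: "\<forall>\<^sub>F n in sequentially. b n \<noteq> 0 \<and> b n * b (n + 2) / (b (n + 1))\<^sup>2 = 1 - V (n + k + 1)"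
  proof -
    have "\<forall>\<^sub>F n in sequentially. (phi ^^ k) a n \<noteq> 0 \<and> (k > 0 \<longrightarrow> (phi ^^ k) a n > 0) \<and>
      (phi ^^ k) a n * (phi ^^ k) a (n + 2) / ((phi ^^ k) a (n + 1))\<^sup>2 = 1 - (ratio_step_seq ^^ k) U (n + k + 1)"
      by (rule Suc.IH) (rule Suc.prems, simp)
    then show ?thesis unfolding b_def V_def by eventually_elim blast
  qed
  have bV': "\<forall>\<^sub>F n in sequentially. b (n + j) \<noteq> 0 \<and>
      b (n + j) * b (n + j + 2) / (b (n + j + 1))\<^sup>2 = 1 - V (n + j + k + 1)" for j
    using eventually_compose_filterlim[OF bV filterlim_add_const_nat_at_top[of j]] .
  have V: "\<forall>\<^sub>F n in sequentially. V n > 0"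
    unfolding V_def by (rule Suc.prems) simp
  have V': "\<forall>\<^sub>F n in sequentially. V (n + j) > 0" for j
    using eventually_compose_filterlim[OF V filterlim_add_const_nat_at_top[of j]] .
  have c: "\<forall>\<^sub>F n in sequentially. phi b n = (b (n + 1))\<^sup>2 * V (n + k + 1) \<and> phi b n > 0"
    using bV bV'[of 1] V'[of "k + 1"]
  proof eventually_elim
    case (elim n)
    have "b n * b (n + 2) = (b (n + 1))\<^sup>2 * (1 - V (n + k + 1))"
      using elim(1,2) by (simp add: divide_eq_eq)
    then have "phi b n = (b (n + 1))\<^sup>2 * V (n + k + 1)"
      unfolding phi_def by (simp add: right_diff_distrib)
    moreover have "V (n + k + 1) > 0" using elim(3) by (simp add: add.assoc)
    ultimately show ?case using elim(2) by simp
  qed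
  have c': "\<forall>\<^sub>F n in sequentially. phi b (n + j) = (b (n + j + 1))\<^sup>2 * V (n + j + k + 1) \<and> phi b (n + j) > 0" for j
    using eventually_compose_filterlim[OF c filterlim_add_const_nat_at_top[of j]] .
  have "\<forall>\<^sub>F n in sequentially. phi b n \<noteq> 0 \<and> (Suc k > 0 \<longrightarrow> phi b n > 0) \<and>
    phi b n * phi b (n + 2) / (phi b (n + 1))\<^sup>2 = 1 - ratio_step_seq V (n + Suc k + 1)"
    using c'[of 0] c'[of 1] c'[of 2] bV'[of 1] bV'[of 2] bV'[of 3]
  proof eventually_elim
    case (elim n)
    have idx: "n + 1 + 2 = n + 3" "n + 1 + 1 = n + 2" "n + 2 + 1 = n + 3" "n + 0 = n"
       "n + 1 + k + 1 = n + k + 2" "n + 2 + k + 1 = n + k + 3" by auto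
    note e = elim[unfolded idx]
    have b: "b (n + 1) * b (n + 3) / (b (n + 2))\<^sup>2 = 1 - V (n + k + 2)"
      using e(4) by blast
    have "phi b n * phi b (n + 2) / (phi b (n + 1))\<^sup>2 =
       ((b (n + 1))\<^sup>2 * V (n + k + 1)) * ((b (n + 3))\<^sup>2 * V (n + k + 3)) / ((b (n + 2))\<^sup>2 * V (n + k + 2))\<^sup>2"
      unfolding e(1)[THEN conjunct1] e(2)[THEN conjunct1] e(3)[THEN conjunct1] ..
    \<comment> \<open>The factors b regroup into the squared ratio of b centred at n + 2.\<close>
    also have "\<dots> = (b (n + 1) * b (n + 3) / (b (n + 2))\<^sup>2)\<^sup>2 * (V (n + k + 1) * V (n + k + 3) / (V (n + k + 2))\<^sup>2)"
      by (simp add: power_mult_distrib power_divide mult_ac)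
    also have "\<dots> = 1 - ratio_step_seq V (n + k + 2)"
      unfolding b ratio_step_seq_def by (simp add: numeral_3_eq_3)
    finally have "phi b n * phi b (n + 2) / (phi b (n + 1))\<^sup>2 = 1 - ratio_step_seq V (n + Suc k + 1)"
      by simp
    moreover have "phi b n > 0" using e(1) by blast
    ultimately show ?case by simp
  qed
  then show ?case by (simp add: b_def V_def)
qed

text \<open>The sign of the k-th iterate of phi is governed by the iterates of \<open>U\<close>
  below k. Finitely many k share one threshold N, and phi commutes with the shift by N.\<close>

lemma asymp_fold_log_concaveI:
  assumes a: "\<forall>\<^sub>F n in sequentially. a n \<noteq> 0"
    and U: "U = (\<lambda>n. 1 - a (n - 1) * a (n + 1) / (a n)\<^sup>2)"
    and pos: "\<And>k. k < l \<Longrightarrow> \<forall>\<^sub>F n in sequentially. (ratio_step_seq ^^ k) U n > 0"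
  shows "asymp_fold_log_concave l a"
proof -
  have "\<forall>\<^sub>F n in sequentially. \<forall>k\<in>{1..l}. (phi ^^ k) a n \<ge> 0"
  proof (rule eventually_ball_finite)
    show "\<forall>k\<in>{1..l}. \<forall>\<^sub>F n in sequentially. (phi ^^ k) a n \<ge> 0"
    proof
      fix k assume k: "k \<in> {1..l}"
      have "\<forall>\<^sub>F n in sequentially. (phi ^^ k) a n \<noteq> 0 \<and> (k > 0 \<longrightarrow> (phi ^^ k) a n > 0) \<and>
        (phi ^^ k) a n * (phi ^^ k) a (n + 2) / ((phi ^^ k) a (n + 1))\<^sup>2 = 1 - (ratio_step_seq ^^ k) U (n + k + 1)"
        by (rule phi_iterate_ratio[OF a U]) (rule pos, use k in simp)
      then show "\<forall>\<^sub>F n in sequentially. (phi ^^ k) a n \<ge> 0"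
        by eventually_elim (use k in auto)
    qed
  qed simp
  then obtain N where "\<And>n k. n \<ge> N \<Longrightarrow> k \<in> {1..l} \<Longrightarrow> (phi ^^ k) a n \<ge> 0"
    unfolding eventually_sequentially by blast
  then show ?thesis
    unfolding asymp_fold_log_concave_def fold_log_concave_def phi_iterate_shift
    by (intro exI[of _ N]) auto
qed

section \<open>The initial expansion and the two cases of the leading exponent\<close>

lemma powr_comp_ln_symbols:
  assumes "rational_function r"
  shows "(\<lambda>x. r (ln x) * x powr (-a)) \<in> symbols_ess a"
proof -
  obtain p where "r \<in> symbols p" using rational_function_symbols[OF assms] by blast
  from symbols_ess_mult[OF symbols_ess_comp_ln[OF this] symbols_subset_ess[OF symbols_powr[of "-a"]]]
  show ?thesis by simp
qed

text \<open>The terms with i \<ge> 2 are smaller by a power, whatever their logarithmic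
  coefficients, and go into \<open>h\<close>. Weakening o to O is harmless because the error budget
  compares its exponent with \<beta> strictly.\<close>

lemma initial_log_expansion:
  fixes \<alpha> :: "nat \<Rightarrow> real"
  assumes m: "m \<ge> 1" and mono: "strict_mono_on {1..m} \<alpha>"
    and r: "\<forall>i\<in>{1..m}. rational_function (r i)"
    and b: "(\<lambda>n. b n - (1 + (\<Sum>i=1..m. r i (ln (real n)) / real n powr \<alpha> i)))
      \<in> o[sequentially](\<lambda>n. 1 / real n powr \<beta>)"
  shows "log_expansion (\<alpha> 1) (\<lambda>y. - r 1 y) \<beta> (\<lambda>n. 1 - b n)"
proof -
  define S where "S = (\<lambda>x::real. \<Sum>i=2..m. r i (ln x) * x powr (- \<alpha> i))"
  have S: "S \<in> symbols_sub (\<alpha> 1)"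
    unfolding S_def
  proof (rule symbols_sub_sum)
    fix i assume i: "i \<in> {2..m}"
    then have "\<alpha> 1 < \<alpha> i" by (intro strict_mono_onD[OF mono]) auto
    then show "(\<lambda>x. r i (ln x) * x powr (- \<alpha> i)) \<in> symbols_sub (\<alpha> 1)"
      using i r by (intro symbols_ess_imp_sub[OF powr_comp_ln_symbols]) auto
  qed
  define h where "h = (\<lambda>x. - 1 * (S x * x powr \<alpha> 1))"
  have h: "h \<in> symbols_sub 0"
    unfolding h_def
    using symbols_sub_mult[OF S symbols_subset_ess[OF symbols_powr[of "\<alpha> 1"]]]
    by (intro symbols_sub_cmult) simp
  define e where "e = (\<lambda>n. - (b n - (1 + (\<Sum>i=1..m. r i (ln (real n)) / real n powr \<alpha> i))))"
  have "e \<in> o(\<lambda>n. real n powr (-\<beta>))"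
    unfolding e_def using b by (subst landau_o.small.uminus_in_iff) (simp add: powr_minus_divide)
  then have e: "e \<in> O(\<lambda>n. real n powr (-\<beta>))" by (rule landau_o.small_imp_big)
  have "\<forall>\<^sub>F n in sequentially. 1 - b n = real n powr (- \<alpha> 1) * (- r 1 (ln (real n)) + h (real n)) + e n"
    using eventually_gt_at_top[of 0]
  proof eventually_elim
    case (elim n)
    have "(\<Sum>i=1..m. r i (ln (real n)) / real n powr \<alpha> i) =
        r 1 (ln (real n)) * real n powr (- \<alpha> 1) + S (real n)"
      using m by (simp add: sum.atLeast_Suc_atMost S_def powr_minus_divide numeral_2_eq_2)
    then have "1 - b n = - r 1 (ln (real n)) * real n powr (- \<alpha> 1) - S (real n) + e n"
      by (simp add: e_def)
    moreover have "real n powr (- \<alpha> 1) * h (real n) = - S (real n)"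
      using elim by (simp add: h_def powr_minus)
    ultimately show ?case by (simp only: distrib_left) (simp add: mult.commute)
  qed
  then show ?thesis unfolding log_expansion_def by (rule bexI[OF bexI[OF _ e] h])
qed

text \<open>For \<alpha> < 2 the second differences contribute at x powr (-2), negligible against x
  powr (-\<alpha>), so each step merely doubles the coefficient.\<close>

lemma iterated_ratio_step_pos_lt_2:
  assumes \<alpha>: "0 < \<alpha>" "\<alpha> < 2" and U: "log_expansion \<alpha> g \<gamma> U" and \<gamma>: "\<gamma> > real l * \<alpha>"
    and g: "elliptic t g" and k: "k < l"
  shows "\<forall>\<^sub>F n in sequentially. (ratio_step_seq ^^ k) U n > 0"
proof (rule iterated_ratio_step_pos[where g = "\<lambda>k y. 2 ^ k * g y" and t = "\<lambda>_. t"])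
  show ell: "elliptic t (\<lambda>y. 2 ^ k * g y)" for k
    by (rule elliptic_cmult[OF g]) simp
  show "(\<lambda>x. 2 * (x powr -\<alpha> * (2 ^ k * g (ln x))) - x powr - 2 * (\<alpha> + curvature (\<lambda>y. 2 ^ k * g y) (ln x))
          - x powr -\<alpha> * (2 ^ Suc k * g (ln x))) \<in> symbols_sub \<alpha>" for k
  proof -
    let ?g = "\<lambda>y. 2 ^ k * g y"
    have "curvature ?g \<in> symbols (- t + 1 + t)"
      using ell[of k] by (intro curvature_symbols log_deriv_symbols symbols_deriv elliptic_inverse)
        (auto simp: elliptic_def)
    then have "(\<lambda>x. curvature ?g (ln x)) \<in> symbols_ess 0"
      by (rule symbols_ess_comp_ln)
    then have "(\<lambda>x. \<alpha> + curvature ?g (ln x)) \<in> symbols_ess 0"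
      by (rule symbols_ess_add[OF symbols_subset_ess[OF symbols_const]])
    from symbols_ess_mult[OF symbols_subset_ess[OF symbols_powr[of "-2"]] this]
    have "(\<lambda>x. x powr -2 * (\<alpha> + curvature ?g (ln x))) \<in> symbols_ess 2" by simp
    then have "(\<lambda>x. - 1 * (x powr -2 * (\<alpha> + curvature ?g (ln x)))) \<in> symbols_sub \<alpha>"
      using \<alpha> by (intro symbols_sub_cmult symbols_ess_imp_sub) auto
    then show ?thesis by (simp add: mult_ac)
  qed
qed (use assms in auto)

definition critical_step :: "(real \<Rightarrow> real) \<Rightarrow> real \<Rightarrow> real" where
  "critical_step g y = 2 * g y - 2 - curvature g y"

text \<open>
  Without the curvature, \<open>critical_step\<close> is \<open>z \<mapsto> 2 * z - 2\<close>, whose \<open>k\<close>-th iterate maps the starting value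
  to \<open>2 ^ k * D + 2 - 2 ^ k / 2 powi (l - 2)\<close>. The constant part is positive for \<open>k < l - 1\<close> but
  vanishes for \<open>k = l - 1\<close>, where positivity depends on \<open>D\<close>; the curvature terms are harmless because
  they have strictly smaller order than \<open>D\<close>.
\<close>

lemma iterated_critical_step_elliptic:
  assumes D: "elliptic s D" and k: "k < l"
  defines "g \<equiv> \<lambda>y. D y + 2 - 1 / 2 powi (int l - 2)"
  shows "\<exists>t. elliptic t ((critical_step ^^ k) g)"
proof -
  \<comment> \<open>Iterates of z -> 2 z - 2: the distance to the fixed point 2 doubles in each
    step.\<close>
  define c where "c = (\<lambda>k. 2 - 2 ^ k / 2 powi (int l - 2) :: real)"
  have c_Suc: "c (Suc k) = 2 * c k - 2" for k by (simp add: c_def)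
  have c_last: "c k = 0" if "Suc k = l" for k
  proof -
    have "1 + (int l - 2) = int k" using that by simp
    then have "(2::real) ^ k = 2 powi (1 + (int l - 2))" by (simp only: power_int_of_nat)
    also have "\<dots> = 2 * 2 powi (int l - 2)" by (subst power_int_add) auto
    finally show ?thesis by (simp add: c_def)
  qed
  have c_pos: "c k > 0" if "Suc k < l" for k
  proof -
    have "(2::real) powi (int k) < 2 powi (1 + (int l - 2))"
      using that by (intro power_int_strict_increasing) auto
    also have "\<dots> = 2 * 2 powi (int l - 2)" by (subst power_int_add) auto
    finally show ?thesis by (simp add: c_def field_simps)
  qed
  have D2: "elliptic s (\<lambda>y. 2 ^ k * D y)" for k
    by (rule elliptic_cmult[OF D]) simp
  \<comment> \<open>While the constant part is positive, the sum grows at least like a constant; at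
    k = l - 1 it vanishes and \<open>D\<close> decides alone, with exponent s of either
    sign.\<close>
  have ell: "elliptic (if Suc k < l then max s 0 else s) (\<lambda>y. 2 ^ k * D y + c k + q y)"
    if q: "q \<in> symbols (1 - s)" and k: "k < l" for q k
  proof (cases "Suc k < l")
    case True
    then show ?thesis
      using elliptic_add_lower[OF elliptic_add_const[OF D2 c_pos] q, of k] by auto
  next
    case False
    with k have "Suc k = l" by simp
    then show ?thesis
      using elliptic_add_lower[OF D2 q, of k] c_last[of k] by simp
  qed
  \<comment> \<open>\<open>q\<close> collects the curvature terms, one order smaller than
    \<open>D\<close>.\<close>
  have "\<exists>q\<in>symbols (1 - s). (critical_step ^^ k) g = (\<lambda>y. 2 ^ k * D y + c k + q y)"
    using k
  proof (induction k)
    case 0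
    have "(critical_step ^^ 0) g = (\<lambda>y. 2 ^ 0 * D y + c 0 + 0)"
      by (simp add: g_def c_def add_diff_eq)
    then show ?case using symbols_zero by (intro bexI[where x = "\<lambda>_. 0"])
  next
    case (Suc k)
    then obtain q where q: "q \<in> symbols (1 - s)"
      and gk: "(critical_step ^^ k) g = (\<lambda>y. 2 ^ k * D y + c k + q y)" by auto
    let ?g = "\<lambda>y. 2 ^ k * D y + c k + q y"
    \<comment> \<open>Step k is not the last one, so c k > 0 and the growth exponent max s 0 is
      nonnegative; hence the reciprocal has order 0 even if \<open>D\<close> decays.\<close>
    have g1: "(\<lambda>y. 1 / ?g y) \<in> symbols 0"
      using elliptic_inverse[OF ell[OF q, of k]] Suc.prems by (auto elim: symbols_mono)
    have Ds: "D \<in> symbols (-s)" using D by (simp add: elliptic_def)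
    \<comment> \<open>Differentiation removes the constant c k, so the order 1 - s comes from
      \<open>D\<close> alone and passes on to the curvature.\<close>
    have "(\<lambda>y. 2 ^ k * deriv D y + deriv q y) \<in> symbols (1 - s)"
      using symbols_deriv[OF Ds] symbols_mono[OF symbols_deriv[OF q], of "1 - s"]
      by (intro symbols_add symbols_cmult) auto
    moreover have "\<forall>\<^sub>F y in at_top. 2 ^ k * deriv D y + deriv q y = deriv ?g y"
      using symbols_has_deriv[OF Ds] symbols_has_deriv[OF q]
    proof eventually_elim
      case (elim y)
      have "(?g has_real_derivative 2 ^ k * deriv D y + deriv q y) (at y)"
        using elim by (auto intro!: derivative_eq_intros)
      then show ?case by (simp add: DERIV_imp_deriv)
    qed
    ultimately have "deriv ?g \<in> symbols (1 - s)" by (rule symbols_cong)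
    from curvature_symbols[OF log_deriv_symbols[OF this g1]]
    have "curvature ?g \<in> symbols (1 - s)" by simp
    then have "(\<lambda>y. 2 * q y - curvature ?g y) \<in> symbols (1 - s)"
      by (intro symbols_diff symbols_cmult q)
    moreover have "(critical_step ^^ Suc k) g = (\<lambda>y. 2 ^ Suc k * D y + c (Suc k) + (2 * q y - curvature ?g y))"
      unfolding funpow.simps o_apply gk
      by (rule ext) (simp add: critical_step_def c_Suc algebra_simps)
    ultimately show ?case by (intro bexI[where x = "\<lambda>y. 2 * q y - curvature ?g y"])
  qed
  then show ?thesis using ell k by metis
qed

text \<open>For \<alpha> = 2 the doubled coefficient and the second differences both sit at x powr
  (-2). \<open>critical_step\<close> collects them exactly, so the remainder in each step is
  zero.\<close>

lemma iterated_ratio_step_pos_eq_2: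
  assumes U: "log_expansion 2 g \<gamma> U" and \<gamma>: "\<gamma> > real l * 2"
    and D: "elliptic s D" and g: "g = (\<lambda>y. D y + 2 - 1 / 2 powi (int l - 2))" and k: "k < l"
  shows "\<forall>\<^sub>F n in sequentially. (ratio_step_seq ^^ k) U n > 0"
proof -
  have "\<forall>k. \<exists>t. k < l \<longrightarrow> elliptic t ((critical_step ^^ k) g)"
    using iterated_critical_step_elliptic[OF D, of _ l] unfolding g by blast
  then obtain t where t: "\<And>k. k < l \<Longrightarrow> elliptic (t k) ((critical_step ^^ k) g)"
    by metis
  show ?thesis
  proof (rule iterated_ratio_step_pos[where g = "\<lambda>k. (critical_step ^^ k) g" and t = t])
    show "(\<lambda>x. 2 * (x powr - 2 * (critical_step ^^ k) g (ln x)) -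
            x powr - 2 * (2 + curvature ((critical_step ^^ k) g) (ln x)) -
            x powr - 2 * (critical_step ^^ Suc k) g (ln x)) \<in> symbols_sub 2" for k
      using symbols_sub_zero by (simp add: critical_step_def algebra_simps)
  qed (use U \<gamma> k t in auto)
qed

theorem theorem3p2:
  fixes a :: "nat \<Rightarrow> real" and m l :: nat and \<alpha> :: "nat \<Rightarrow> real" and \<beta> :: real
    and r :: "nat \<Rightarrow> real \<Rightarrow> real"
  assumes "\<forall>\<^sub>F n in sequentially. a n \<noteq> 0"
    and "m \<ge> 1"
    and "0 < \<alpha> 1" and "strict_mono_on {1..m} \<alpha>" and "\<alpha> m < \<beta>"
    and "\<forall>i\<in>{1..m}. rational_function (r i)"
    and "(\<lambda>n::nat. a (n - 1) * a (n + 1) / (a n)\<^sup>2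
           - (1 + (\<Sum>i=1..m. r i (ln (real n)) / real n powr \<alpha> i)))
         \<in> o[sequentially](\<lambda>n. 1 / real n powr \<beta>)"
    and "l = nat \<lfloor>\<alpha> m / \<alpha> 1\<rfloor>"
    and "(0 < \<alpha> 1 \<and> \<alpha> 1 < 2 \<and> (\<forall>\<^sub>F x in at_top. r 1 x < 0)) \<or>
         (\<alpha> 1 = 2 \<and> (\<forall>\<^sub>F x in at_top. r 1 x < - 2 + 1 / 2 powi (int l - 2)))"
  shows "asymp_fold_log_concave l a"
proof -
  define U where "U = (\<lambda>n. 1 - a (n - 1) * a (n + 1) / (a n)\<^sup>2)"
  have U: "log_expansion (\<alpha> 1) (\<lambda>y. - r 1 y) \<beta> U"
    unfolding U_def by (rule initial_log_expansion[OF assms(2,4,6,7)])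
  have "\<alpha> 1 \<le> \<alpha> m"
    using assms(2) by (intro strict_mono_on_leD[OF assms(4)]) auto
  \<comment> \<open>\<open>l\<close> is a floor, so l times \<alpha> 1 is at most \<alpha> m <
    \<beta>, and the error budget covers l steps.\<close>
  then have "real l \<le> \<alpha> m / \<alpha> 1"
    using assms(3) unfolding assms(8) by (subst of_nat_nat) auto
  then have l: "real l * \<alpha> 1 < \<beta>"
    using assms(3,5) by (simp add: field_simps)
  have r1: "rational_function (r 1)" using assms(2,6) by auto
  show ?thesis
  proof (rule asymp_fold_log_concaveI[OF assms(1) U_def])
    fix k assume k: "k < l"
    show "\<forall>\<^sub>F n in sequentially. (ratio_step_seq ^^ k) U n > 0"
      using assms(9)
    proof (elim disjE conjE)
      assume lt: "\<alpha> 1 < 2" and neg: "\<forall>\<^sub>F x in at_top. r 1 x < 0"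
      have "\<forall>\<^sub>F x in at_top. 0 - r 1 x > 0" using neg by eventually_elim simp
      from rational_function_elliptic[OF rational_function_affine[OF r1] this]
      obtain t where t: "elliptic t (\<lambda>y. - r 1 y)" by auto
      show ?thesis
        by (rule iterated_ratio_step_pos_lt_2[OF assms(3) lt U l t k])
    next
      assume eq: "\<alpha> 1 = 2" and neg: "\<forall>\<^sub>F x in at_top. r 1 x < - 2 + 1 / 2 powi (int l - 2)"
      \<comment> \<open>The gap between the threshold and \<open>r 1\<close> serves as
        \<open>D\<close>, so that - r 1 = D + 2 - 1 / 2 powi (l - 2).\<close>
      have "\<forall>\<^sub>F x in at_top. (- 2 + 1 / 2 powi (int l - 2)) - r 1 x > 0" using neg by eventually_elim simp
      from rational_function_elliptic[OF rational_function_affine[OF r1] this]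
      obtain s where s: "elliptic s (\<lambda>y. (- 2 + 1 / 2 powi (int l - 2)) - r 1 y)" by auto
      show ?thesis
        by (rule iterated_ratio_step_pos_eq_2[OF U[unfolded eq] l[unfolded eq] s _ k]) auto
    qed
  qed
qed

end
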